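(* Let $p$ be a prime, $n\ge 1$ an integer, and let $F$ be a finite field of characteristic $p$ with $q=p^n$ elements. Let $U(F[C_8\times C_4])$ be the unit group of the group algebra $F[C_8\times C_4]$. (1) If $p=2$, then $$U(F[C_8\times C_4])\cong C_{8}^{n}\times C_{4}^{5n}\times C_{2}^{18n}\times C_{2^n-1}.$$ (2) If $p\neq 2$, then $U(F[C_8\times C_4])$ is isomorphic to: - $C_{p^n-1}^{32}$, if $q\equiv 1\pmod 8$; - $C_{p^n-1}^{4}\times C_{p^{2n}-1}^{14}$, if $q\equiv -1\pmod 8$; - $C_{p^n-1}^{4}\times C_{p^{2n}-1}^{14}$, if $q\equiv 3\pmod 8$; - $C_{p^n-1}^{16}\times C_{p^{2n}-1}^{8}$, if $q\equiv -3\pmod 8$.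
   Context: $C_m$ denotes the cyclic group of order $m$, and $C_m^k$ denotes the direct product of $k$ copies of $C_m$. For a group $G$ and a field $F$, $FG$ (also written $F[G]$) is the group algebra and $U(FG)$ is the multiplicative group of all its invertible elements. *)

theory Defs
  imports "HOL-Algebra.Algebra" "HOL-Number_Theory.Cong"
begin

definition ring_char :: "('a, 'm) ring_scheme \<Rightarrow> nat" where
  "ring_char R = group.ord (add_monoid R) \<one>\<^bsub>R\<^esub>"

definition support :: "('a, 'm) ring_scheme \<Rightarrow> ('g, 'l) monoid_scheme \<Rightarrow> ('g \<Rightarrow> 'a) \<Rightarrow> 'g set" where
  "support R G f = {x \<in> carrier G. f x \<noteq> \<zero>\<^bsub>R\<^esub>}"

(* A function f stands for the formal sum of the terms f(x) x over x in G.  The coefficient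
   of x in a product sums f(y) g(z) over all pairs with y z = x; it ranges over the (finite)
   support of f because finsum is only meaningful over finite sets. *)
definition group_algebra ::
    "('a, 'm) ring_scheme \<Rightarrow> ('g, 'l) monoid_scheme \<Rightarrow> ('g \<Rightarrow> 'a) ring" where
  "group_algebra R G =
    \<lparr>carrier = {f \<in> carrier G \<rightarrow>\<^sub>E carrier R. finite (support R G f)},
     monoid.mult = (\<lambda>f g. \<lambda>x\<in>carrier G.
       \<Oplus>\<^bsub>R\<^esub>y\<in>support R G f. f y \<otimes>\<^bsub>R\<^esub> g (inv\<^bsub>G\<^esub> y \<otimes>\<^bsub>G\<^esub> x)),
     one = (\<lambda>x\<in>carrier G. if x = \<one>\<^bsub>G\<^esub> then \<one>\<^bsub>R\<^esub> else \<zero>\<^bsub>R\<^esub>),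
     ring.zero = (\<lambda>x\<in>carrier G. \<zero>\<^bsub>R\<^esub>),
     ring.add = (\<lambda>f g. \<lambda>x\<in>carrier G. f x \<oplus>\<^bsub>R\<^esub> g x)\<rparr>"

abbreviation cyclic :: "nat \<Rightarrow> int monoid" where
  "cyclic m \<equiv> integer_mod_group m"

abbreviation cyclic_power :: "nat \<Rightarrow> nat \<Rightarrow> (nat \<Rightarrow> int) monoid" where
  "cyclic_power m k \<equiv> product_group {..<k} (\<lambda>_. integer_mod_group m)"

end

(*
  A finite abelian group is determined up to isomorphism by the number of solutions of x^d = 1
  for every d > 0: both groups split off a cyclic factor of maximal order, and one inducts.
  So it suffices to count these solutions among the units of F[G], G = C_8 x C_4.

  If p = 2, then the 2^k-th power of a sum of terms f(x) x is the sum of the terms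
  f(x)^(2^k) x^(2^k), so it equals 1 iff the sums of f over the fibres of x -> x^(2^k) are
  prescribed; this leaves q^(32 - |G^(2^k)|) choices of f. As the 8th power of u is a constant,
  the units are the 1-units times the nonzero constants.

  If p is odd, let K be the quadratic extension of F. It contains a primitive 8th root of unity w,
  and the 32 characters of G with values in K embed F[G] into K^32. By cardinality the image
  consists of the vectors that are compatible with the conjugation of K over F, which maps w to
  some w^t and hence permutes the characters as the t-th power map: each fixed character contributes
  a copy of F, each pair of conjugate ones a copy of K. The residue of q modulo 8 decides whether
  t = 1, t = 5 or t is 3 or 7; the last two values have the same number of fixed characters.
*)
theory Submission
  imports Defs
begin

section \<open>Torsion counts of finite abelian groups\<close>

text \<open>Counting avoids choosing generators of the 1-units in characteristic 2. For k = 0, 1, 2,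
  3 the group G^(2^k) has 32, 8, 2, 1 elements, so x^(2^k) = 1 has q^0, q^24, q^30, q^31 solutions.
  The increments 24, 6, 1, times n, count the cyclic factors of order at least 2, 4, 8; the
  exponents 18 = 24 - 6, 5 = 6 - 1 and 1 of the theorem are their differences. In odd characteristic
  one quadratic extension serves every q, because 8 divides q^2 - 1 for all odd q; conjugation is
  then an involution and no orbit of characters has more than two elements. Index the characters by
  (r, s) with r modulo 8 and s modulo 4. For t = 5 the fixed ones have r even, which gives 16 and
  leaves 8 pairs; for t = 3 or 7 they have r in {0, 4} and s in {0, 2}, which gives 4 and leaves 14
  pairs. Fourier inversion supplies injectivity of the embedding, and it works because 8 and 4 are
  nonzero in K.\<close>

definition torsion :: "('a, 'b) monoid_scheme \<Rightarrow> nat \<Rightarrow> 'a set" where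
  "torsion G d = {x \<in> carrier G. x [^]\<^bsub>G\<^esub> d = \<one>\<^bsub>G\<^esub>}"

text \<open>Dividing d and N by their gcd g leaves coprime numbers e and M, so N divides d i iff M
  divides i, and there are g multiples of M below g M.\<close>

lemma card_multiples_mod:
  fixes N d :: nat
  assumes "N > 0"
  shows "card {i \<in> {..<N}. N dvd d * i} = gcd d N"
proof -
  define g M where "g = gcd d N" and "M = N div g"
  have N: "N = g * M" and g: "g > 0" using assms by (simp_all add: g_def M_def)
  then have M: "M > 0" using assms by (metis gr0I mult_0_right)
  have "N dvd d * i \<longleftrightarrow> M dvd i" for i
  proof -
    obtain e where e: "d = g * e" unfolding g_def by (metis dvdE gcd_dvd1)
    have "coprime M e"
    proof -
      have "gcd d N = g * gcd e M" unfolding N e by (simp add: gcd_mult_distrib_nat)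
      then have "gcd e M = 1" using g unfolding g_def[symmetric] by simp
      then show ?thesis by (simp add: coprime_iff_gcd_eq_1 gcd.commute)
    qed
    then show ?thesis using g unfolding N e by (simp add: mult.assoc coprime_dvd_mult_right_iff)
  qed
  then have "{i \<in> {..<N}. N dvd d * i} = (\<lambda>k. M * k) ` {..<g}"
    using M unfolding N by (auto simp: image_iff elim!: dvdE)
  also have "card \<dots> = g" using M by (subst card_image) (auto simp: inj_on_def)
  finally show ?thesis by (simp add: g_def)
qed

lemma (in group) pow_mod_ord:
  fixes n :: nat
  assumes "a \<in> carrier G"
  shows "a [^] (n mod ord a) = a [^] n"
proof -
  have "a [^] n = a [^] (n mod ord a + ord a * (n div ord a))" by simp
  also have "\<dots> = a [^] (n mod ord a) \<otimes> (a [^] ord a) [^] (n div ord a)"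
    using assms by (simp only: nat_pow_mult nat_pow_pow nat_pow_closed)
  finally show ?thesis using assms by simp
qed

lemma (in group) bij_betw_pow_generator:
  assumes "finite (carrier G)" "a \<in> carrier G" "ord a = order G"
  shows "bij_betw (\<lambda>i::nat. a [^] i) {..<order G} (carrier G)"
proof -
  have "order G > 0" using assms(1) order_gt_0_iff_finite by auto
  then have eq: "{0..ord a - 1} = {..<order G}" using assms by auto
  have inj: "inj_on (\<lambda>i::nat. a [^] i) {..<order G}" using ord_inj[OF assms(2)] eq by simp
  moreover have "(\<lambda>i::nat. a [^] i) ` {..<order G} = carrier G"
    by (rule card_subset_eq) (use assms inj in \<open>auto simp: card_image order_def\<close>)
  ultimately show ?thesis by (simp add: bij_betw_def)
qed

text \<open>Elements are powers of \<open>a\<close> with exponent i below the order, which turns x^d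
  = 1 into a divisibility condition on d i.\<close>

lemma (in group) card_torsion_cyclic:
  assumes "finite (carrier G)" "a \<in> carrier G" "ord a = order G"
  shows "card (torsion G d) = gcd d (order G)"
proof -
  note b = bij_betw_pow_generator[OF assms]
  have pos: "order G > 0" using assms(1) order_gt_0_iff_finite by auto
  have "(a [^] i) [^] d = \<one> \<longleftrightarrow> order G dvd d * i" for i :: nat
    using assms by (simp add: nat_pow_pow pow_eq_id mult.commute)
  moreover have "torsion G d = (\<lambda>i::nat. a [^] i) ` {i \<in> {..<order G}. (a [^] i) [^] d = \<one>}"
    using b by (auto simp: torsion_def bij_betw_def)
  ultimately have "torsion G d = (\<lambda>i::nat. a [^] i) ` {i \<in> {..<order G}. order G dvd d * i}"
    by simp
  moreover have "inj_on (\<lambda>i::nat. a [^] i) {i \<in> {..<order G}. order G dvd d * i}"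
    using b by (auto simp: bij_betw_def intro: inj_on_subset)
  ultimately show ?thesis using card_multiples_mod[OF pos] by (simp add: card_image)
qed

lemma (in group) iso_integer_mod_group:
  assumes "finite (carrier G)" "a \<in> carrier G" "ord a = order G"
  shows "integer_mod_group (order G) \<cong> G"
proof -
  note b = bij_betw_pow_generator[OF assms]
  have pos: "order G > 0" using assms(1) order_gt_0_iff_finite by auto
  have "(\<lambda>i. a [^] nat i) \<in> iso (integer_mod_group (order G)) G"
  proof (rule isoI)
    show "(\<lambda>i. a [^] nat i) \<in> hom (integer_mod_group (order G)) G"
    proof (rule homI)
      fix x y assume "x \<in> carrier (integer_mod_group (order G))" "y \<in> carrier (integer_mod_group (order G))"
      then obtain m n where mn: "x = int m" "y = int n"
        using pos by (auto simp: carrier_integer_mod_group intro: zero_le_imp_eq_int elim!: nonneg_int_cases)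
      \<comment> \<open>Addition of residues reduces modulo \<open>order G = ord a\<close>, which
        does not change the power of \<open>a\<close>.\<close>
      have "a [^] ((m + n) mod order G) = a [^] (m + n)"
        using assms pow_mod_ord by metis
      then show "a [^] nat (x \<otimes>\<^bsub>integer_mod_group (order G)\<^esub> y) = a [^] nat x \<otimes> a [^] nat y"
        using assms by (simp add: mn nat_pow_mult nat_mod_distrib nat_add_distrib)
    qed (use assms in auto)
    have "bij_betw nat (carrier (integer_mod_group (order G))) {..<order G}"
      using pos by (intro bij_betw_byWitness[where f' = int]) (auto simp: carrier_integer_mod_group)
    from bij_betw_trans[OF this b] show "bij_betw (\<lambda>i. a [^] nat i) (carrier (integer_mod_group (order G))) (carrier G)"
      by (simp add: o_def)
  qed
  then show ?thesis by (rule is_isoI)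
qed

text \<open>This includes m = 0, where the group is all of the integers and the cardinality of an
  infinite set is 0 by convention.\<close>

lemma order_integer_mod_group: "order (integer_mod_group m) = m"
  by (simp add: order_def carrier_integer_mod_group)

lemma card_torsion_integer_mod_group:
  assumes "m > 0"
  shows "card (torsion (integer_mod_group m) d) = gcd d m"
proof -
  have "torsion (integer_mod_group m) d = int ` {i \<in> {..<m}. m dvd d * i}"
  proof (intro equalityI subsetI)
    fix x assume x: "x \<in> torsion (integer_mod_group m) d"
    then have "0 \<le> x" "x < int m" "int m dvd int d * x"
      using assms by (auto simp: torsion_def carrier_integer_mod_group mod_eq_0_iff_dvd)
    then show "x \<in> int ` {i \<in> {..<m}. m dvd d * i}"
      by (intro image_eqI[of _ _ "nat x"]) (auto simp flip: int_dvd_int_iff)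
  next
    fix x assume "x \<in> int ` {i \<in> {..<m}. m dvd d * i}"
    then show "x \<in> torsion (integer_mod_group m) d"
      using assms by (auto simp: torsion_def carrier_integer_mod_group simp flip: of_nat_mult)
  qed
  then show ?thesis using card_multiples_mod[OF assms] by (simp add: card_image)
qed

lemma pow_DirProd:
  fixes d :: nat
  shows "(x, y) [^]\<^bsub>G \<times>\<times> H\<^esub> d = (x [^]\<^bsub>G\<^esub> d, y [^]\<^bsub>H\<^esub> d)"
  by (induction d) auto

lemma torsion_DirProd: "torsion (G \<times>\<times> H) d = torsion G d \<times> torsion H d"
  by (auto simp: torsion_def pow_DirProd)

lemma pow_product_group:
  fixes d :: nat
  shows "x [^]\<^bsub>product_group I G\<^esub> d = (\<lambda>i\<in>I. x i [^]\<^bsub>G i\<^esub> d)"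
  by (induction d) (auto simp: fun_eq_iff)

lemma torsion_product_group: "torsion (product_group I G) d = (\<Pi>\<^sub>E i\<in>I. torsion (G i) d)"
proof (intro equalityI subsetI)
  fix x assume x: "x \<in> torsion (product_group I G) d"
  then have eq: "(\<lambda>i\<in>I. x i [^]\<^bsub>G i\<^esub> d) = (\<lambda>i\<in>I. \<one>\<^bsub>G i\<^esub>)"
    by (simp add: torsion_def pow_product_group)
  have "x i [^]\<^bsub>G i\<^esub> d = \<one>\<^bsub>G i\<^esub>" if "i \<in> I" for i
    using that arg_cong[OF eq, of "\<lambda>f. f i"] by simp
  then show "x \<in> (\<Pi>\<^sub>E i\<in>I. torsion (G i) d)"
    using x by (auto simp: torsion_def PiE_iff)
next
  fix x assume "x \<in> (\<Pi>\<^sub>E i\<in>I. torsion (G i) d)"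
  then show "x \<in> torsion (product_group I G) d"
    by (auto simp: torsion_def pow_product_group PiE_iff intro!: restrict_ext)
qed

lemma card_torsion_cyclic_power:
  assumes "m > 0"
  shows "card (torsion (cyclic_power m k) d) = gcd d m ^ k"
  by (simp add: torsion_product_group card_PiE card_torsion_integer_mod_group[OF assms])

lemma card_torsion_iso:
  assumes "group G" "group H" "G \<cong> H"
  shows "card (torsion G d) = card (torsion H d)"
proof -
  obtain h where h: "h \<in> iso G H" using assms(3) by (auto simp: is_iso_def)
  interpret group_hom G H h
    using assms h by (auto simp: group_hom_def group_hom_axioms_def iso_def)
  have b: "bij_betw h (carrier G) (carrier H)" using h by (auto simp: iso_def)
  have "h x [^]\<^bsub>H\<^esub> d = \<one>\<^bsub>H\<^esub> \<longleftrightarrow> x [^]\<^bsub>G\<^esub> d = \<one>\<^bsub>G\<^esub>" if "x \<in> carrier G" for x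
    using that b by (metis bij_betw_def G.nat_pow_closed G.one_closed hom_one hom_nat_pow inj_onD)
  then have "bij_betw h (torsion G d) (torsion H d)"
    using b unfolding torsion_def by (auto simp: bij_betw_def inj_on_def image_iff) (metis (no_types, lifting) image_iff)
  then show ?thesis by (rule bij_betw_same_card)
qed


section \<open>Elements of maximal order and complements of the subgroups they generate\<close>

lemma (in comm_group) ord_mult_coprime:
  assumes xy: "x \<in> carrier G" "y \<in> carrier G" and cop: "coprime (ord x) (ord y)"
  shows "ord (x \<otimes> y) = ord x * ord y"
proof (rule dvd_antisym)
  let ?n = "ord (x \<otimes> y)"
  show "?n dvd ord x * ord y" using xy by (rule abelian_ord_mul_divides)
  have one: "x [^] (?n * m) \<otimes> y [^] (?n * m) = \<one>" for m
    using xy pow_eq_id[of "x \<otimes> y" "?n * m"] by (simp add: pow_mult_distrib m_comm)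
  \<comment> \<open>The extra exponent \<open>ord y\<close> removes the factor y; then
    \<open>ord x\<close> divides \<open>?n * ord y\<close>, and coprimality cancels
    \<open>ord y\<close>.\<close>
  have "x [^] (?n * ord y) = \<one>"
    using one[of "ord y"] xy pow_eq_id[of y "?n * ord y"] by simp
  then have "ord x dvd ?n"
    using xy cop by (simp add: pow_eq_id coprime_dvd_mult_left_iff)
  moreover have "y [^] (?n * ord x) = \<one>"
    using one[of "ord x"] xy pow_eq_id[of x "?n * ord x"] by simp
  then have "ord y dvd ?n"
    using xy cop by (simp add: pow_eq_id coprime_dvd_mult_left_iff coprime_commute)
  ultimately show "ord x * ord y dvd ?n" using cop by (simp add: divides_mult)
qed

text \<open>An element \<open>a\<close> of largest order works. If \<open>ord x\<close> did not
  divide \<open>ord a\<close>, some prime p would occur to a higher power in \<open>ord x\<close>,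
  and exchanging the p-part of \<open>a\<close> for that of \<open>x\<close> would give an element
  of larger order.\<close>

lemma (in comm_group) exists_exponent_element:
  assumes fin: "finite (carrier G)"
  shows "\<exists>a\<in>carrier G. \<forall>x\<in>carrier G. ord x dvd ord a"
proof -
  have "finite (ord ` carrier G)" "ord ` carrier G \<noteq> {}" using fin by auto
  then have "Max (ord ` carrier G) \<in> ord ` carrier G" by (rule Max_in)
  then obtain a where a: "a \<in> carrier G" and "ord a = Max (ord ` carrier G)" by auto
  then have max: "ord x \<le> ord a" if "x \<in> carrier G" for x using fin that by simp
  have "ord x dvd ord a" if x: "x \<in> carrier G" for x
  proof (rule ccontr)
    assume "\<not> ord x dvd ord a"
    have pos: "ord a > 0" "ord x > 0" using ord_ge_1[OF fin] a x by (auto simp: Suc_le_eq)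
    obtain p where p: "Factorial_Ring.prime p" and less: "multiplicity p (ord a) < multiplicity p (ord x)"
      using \<open>\<not> ord x dvd ord a\<close> multiplicity_le_imp_dvd[of "ord x" "ord a"] pos
      by (metis less_numeral_extra(3) not_le)
    define j k where "j = multiplicity p (ord a)" and "k = multiplicity p (ord x)"
    \<comment> \<open>\<open>a'\<close> has the order of \<open>a\<close> without its p-part,
      \<open>x'\<close> has order p^k. These orders are coprime, so they multiply.\<close>
    define a' x' where "a' = a [^] (p ^ j)" and "x' = x [^] (ord x div p ^ k)"
    have dvd: "p ^ j dvd ord a" "p ^ k dvd ord x"
      by (simp_all add: j_def k_def multiplicity_dvd)
    have p1: "p > 1" using p by (rule prime_gt_1_nat)
    then have p0: "p > 0" by simp
    have q0: "ord a div p ^ j > 0" using dvd pos by (metis dvd_div_eq_0_iff gr0I less_numeral_extra(3))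
    have carr: "a' \<in> carrier G" "x' \<in> carrier G" using a x by (simp_all add: a'_def x'_def)
    have oa: "ord a' = ord a div p ^ j" using a dvd p0 unfolding a'_def by (intro ord_pow) auto
    have "ord x div p ^ k dvd ord x" using dvd by (metis dvd_div_mult_self dvd_triv_left)
    moreover have "ord x div p ^ k \<noteq> 0" using dvd pos by (metis dvd_div_eq_0_iff not_gr_zero)
    ultimately have ox: "ord x' = p ^ k"
      using x dvd pos unfolding x'_def by (subst ord_pow) (auto elim!: dvdE)
    have "\<not> p dvd ord a'"
      unfolding oa j_def using pos p by (intro multiplicity_decompose) auto
    then have "coprime (ord a') (ord x')"
      unfolding ox using p by (simp add: coprime_commute prime_imp_coprime)
    then have "ord (a' \<otimes> x') = (ord a div p ^ j) * p ^ k"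
      using carr ord_mult_coprime oa ox by simp
    also have "\<dots> > (ord a div p ^ j) * p ^ j"
      using less q0 p1 by (intro mult_strict_left_mono power_strict_increasing) (simp_all add: j_def k_def)
    also have "(ord a div p ^ j) * p ^ j = ord a" using dvd by simp
    finally show False using max[of "a' \<otimes> x'"] carr by simp
  qed
  then show ?thesis using a by blast
qed

text \<open>A subgroup that is maximal among those meeting the cyclic group of \<open>a\<close> trivially is a complement:
  an element \<open>x\<close> outside the product, with least power \<open>x\<^sup>m = k a\<^sup>t\<close> in it, can be divided by
  \<open>a\<^bsup>t/m\<^esup>\<close> because \<open>a\<close> has maximal order, and then it enlarges the subgroup.\<close>

lemma (in comm_group) exists_complement:
  assumes fin: "finite (carrier G)" and a: "a \<in> carrier G"
    and exp: "\<And>x. x \<in> carrier G \<Longrightarrow> ord x dvd ord a"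
  shows "\<exists>K. subgroup K G \<and> generate G {a} \<inter> K = {\<one>} \<and> generate G {a} <#> K = carrier G"
proof -
  let ?A = "generate G {a}"
  have A: "?A = {a [^] i | i :: nat. True}"
    using generate_pow_on_finite_carrier[OF fin a] by auto
  have subA: "subgroup ?A G" using a by (intro generate_is_subgroup) auto
  define P where "P = {K. subgroup K G \<and> ?A \<inter> K = {\<one>}}"
  have "P \<subseteq> Pow (carrier G)" by (auto simp: P_def dest: subgroup.subset)
  then have finP: "finite P" using fin by (meson finite_Pow_iff finite_subset)
  have "{\<one>} \<in> P" using subgroup.one_closed[OF subA] by (auto simp: P_def triv_subgroup)
  then have "Max (card ` P) \<in> card ` P" using finP by (intro Max_in) auto
  then obtain K where K: "K \<in> P" and "card K = Max (card ` P)" by auto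
  then have max: "card K' \<le> card K" if "K' \<in> P" for K' using finP that by simp
  have subK: "subgroup K G" and triv: "?A \<inter> K = {\<one>}" using K by (auto simp: P_def)
  define L where "L = ?A <#> K"
  have subL: "subgroup L G" unfolding L_def using subA subK by (rule mult_subgroups)
  have KL: "K \<subseteq> L"
    using subgroup.one_closed[OF subA] subgroup.subset[OF subK] by (force simp: L_def set_mult_def)
  have AL: "?A \<subseteq> L"
    using subgroup.one_closed[OF subK] subgroup.subset[OF subA] by (force simp: L_def set_mult_def)
  have "x \<in> L" if x: "x \<in> carrier G" for x
  proof (rule ccontr)
    assume "x \<notin> L"
    define m :: nat where "m = (LEAST m. m > 0 \<and> x [^] m \<in> L)"
    have "ord x > 0 \<and> x [^] ord x \<in> L"
      using ord_ge_1[OF fin x] x subgroup.one_closed[OF subL] by simp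
    then have "m > 0 \<and> x [^] m \<in> L" unfolding m_def by (rule LeastI[of "\<lambda>m. m > 0 \<and> x [^] m \<in> L"])
    then have m: "m > 0" "x [^] m \<in> L" by auto
    have least: "m \<le> m'" if "m' > 0" "x [^] m' \<in> L" for m'
      using that unfolding m_def by (intro Least_le) simp
    \<comment> \<open>Division with remainder: x^(s mod m) lies in \<open>L\<close> too, so
      minimality of m forces the remainder to be 0.\<close>
    have mdvd: "m dvd s" if "x [^] s \<in> L" for s :: nat
    proof -
      have powL: "y [^] (n :: nat) \<in> L" if "y \<in> L" for y n
        using that subgroup.one_closed[OF subL] subgroup.m_closed[OF subL] by (induction n) auto
      have "x [^] s = x [^] (s mod m + m * (s div m))" by simp
      also have "\<dots> = x [^] (s mod m) \<otimes> (x [^] m) [^] (s div m)"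
        using x by (simp only: nat_pow_mult nat_pow_pow nat_pow_closed)
      finally have "x [^] (s mod m) = x [^] s \<otimes> inv ((x [^] m) [^] (s div m))"
        using x by (simp add: inv_solve_right)
      then have "x [^] (s mod m) \<in> L"
        using that powL[OF m(2)] subL by (simp add: subgroup.m_closed subgroup.m_inv_closed)
      then have "s mod m = 0" using least[of "s mod m"] m(1) by (metis mod_less_divisor not_le not_gr_zero)
      then show ?thesis by auto
    qed
    have "ord x dvd ord a" using exp x by simp
    then have xN: "x [^] ord a = \<one>" using x by (simp add: pow_eq_id)
    then have "m dvd ord a" using mdvd subgroup.one_closed[OF subL] by simp
    then obtain c where c: "ord a = m * c" by auto
    have c0: "c > 0" using ord_ge_1[OF fin a] c by (metis gr0I mult_0_right not_one_le_zero)
    obtain t k where k: "k \<in> K" and xm: "x [^] m = a [^] (t :: nat) \<otimes> k"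
      using m(2) by (auto simp: L_def set_mult_def A)
    have kc: "k \<in> carrier G" using k subgroup.subset[OF subK] by auto
    have powK: "y [^] (n :: nat) \<in> K" if "y \<in> K" for y n
      using that subgroup.one_closed[OF subK] subgroup.m_closed[OF subK] by (induction n) auto
    \<comment> \<open>The maximal order of \<open>a\<close> enters here: x^(m c) = 1 with m c =
      \<open>ord a\<close>. Hence a^(t c) is the inverse of k^c, lies in both subgroups and equals
      1, so m c divides t c.\<close>
    have "\<one> = (x [^] m) [^] c" using x xN c by (simp add: nat_pow_pow)
    also have "\<dots> = a [^] (t * c) \<otimes> k [^] c"
      using a kc by (simp add: xm pow_mult_distrib m_comm nat_pow_pow)
    finally have "a [^] (t * c) = inv (k [^] c)"
      using a kc by (metis inv_equality nat_pow_closed)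
    then have "a [^] (t * c) \<in> ?A \<inter> K"
      using powK[OF k, of c] subgroup.m_inv_closed[OF subK] unfolding A by (metis (mono_tags, lifting) IntI mem_Collect_eq)
    then have "a [^] (t * c) = \<one>" using triv by auto
    then have "m dvd t" using a c c0 by (simp add: pow_eq_id)
    then obtain s where s: "t = m * s" by auto
    define b where "b = a [^] s"
    have b: "b \<in> ?A" "b \<in> carrier G" using a by (auto simp: b_def A)
    define y where "y = x \<otimes> inv b"
    have y: "y \<in> carrier G" using x b by (simp add: y_def)
    have xy: "x = y \<otimes> b" using x b by (simp add: y_def m_assoc)
    have "y [^] m = k"
    proof -
      have "y [^] m \<otimes> b [^] m = a [^] t \<otimes> k"
        using xm x y b by (simp add: xy pow_mult_distrib m_comm)
      moreover have "b [^] m = a [^] t" using a by (simp add: b_def s nat_pow_pow mult.commute)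
      ultimately show ?thesis using a y kc by (metis m_comm nat_pow_closed r_cancel)
    qed
    have "y \<notin> L" using \<open>x \<notin> L\<close> AL b subL by (auto simp: xy subgroup.m_closed)
    let ?Y = "generate G {y}"
    have Y: "?Y = {y [^] i | i :: nat. True}"
      using generate_pow_on_finite_carrier[OF fin y] by auto
    have subY: "subgroup ?Y G" using y by (intro generate_is_subgroup) auto
    define K' where "K' = K <#> ?Y"
    have subK': "subgroup K' G" unfolding K'_def using subK subY by (rule mult_subgroups)
    \<comment> \<open>If z = k' y^i is a power of \<open>a\<close>, then x^i lies in
      \<open>L\<close>, so m divides i. As y^m = k, also y^i lies in \<open>K\<close>, hence z lies
      in both subgroups.\<close>
    have "z = \<one>" if zA: "z \<in> ?A" and zK': "z \<in> K'" for z
    proof -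
      obtain k' i where k': "k' \<in> K" and z: "z = k' \<otimes> y [^] (i :: nat)"
        using zK' by (auto simp: K'_def set_mult_def Y)
      have k'c: "k' \<in> carrier G" using k' subgroup.subset[OF subK] by auto
      have "x [^] i = y [^] i \<otimes> b [^] i" using y b by (simp add: xy pow_mult_distrib m_comm)
      also have "y [^] i = inv k' \<otimes> z" using k'c y by (simp add: z flip: m_assoc)
      finally have "x [^] i = inv k' \<otimes> z \<otimes> b [^] i" .
      moreover have "b [^] i \<in> ?A" using a by (auto simp: A b_def nat_pow_pow)
      ultimately have "x [^] i \<in> L"
        using KL AL k' zA subL by (auto intro!: subgroup.m_closed[OF subL] subgroup.m_inv_closed[OF subL])
      then obtain e where "i = m * e" using mdvd by blast
      then have "y [^] i = k [^] e" using y \<open>y [^] m = k\<close> by (metis nat_pow_pow)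
      then have "z \<in> K" using z k' powK[OF k] subK by (simp add: subgroup.m_closed)
      then show ?thesis using zA triv by auto
    qed
    then have "?A \<inter> K' = {\<one>}"
      using subgroup.one_closed[OF subA] subgroup.one_closed[OF subK'] by blast
    then have "K' \<in> P" using subK' by (simp add: P_def)
    moreover have "K \<subset> K'"
    proof -
      have "K \<subseteq> K'"
        using subgroup.one_closed[OF subY] subgroup.subset[OF subK] by (force simp: K'_def set_mult_def)
      moreover have "\<one> \<otimes> y \<in> K'"
        using subgroup.one_closed[OF subK] generate.incl[of y "{y}" G] unfolding K'_def set_mult_def by blast
      then have "y \<in> K'" using y by simp
      ultimately show ?thesis using \<open>y \<notin> L\<close> KL by auto
    qed
    then have "card K < card K'"
      using fin subgroup.subset[OF subK'] by (meson finite_subset psubset_card_mono)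
    ultimately show False using max by fastforce
  qed
  then have "L = carrier G" using subgroup.subset[OF subL] by auto
  then show ?thesis using subK triv by (auto simp: L_def)
qed

text \<open>The cyclic subgroup is replaced by \<open>integer_mod_group\<close>, so that two groups
  with the same maximal order get literally the same first factor.\<close>

lemma (in comm_group) exists_cyclic_splitting:
  assumes fin: "finite (carrier G)" and a: "a \<in> carrier G"
    and exp: "\<And>x. x \<in> carrier G \<Longrightarrow> ord x dvd ord a"
  shows "\<exists>K. comm_group (subgroup_generated G K) \<and>
    integer_mod_group (ord a) \<times>\<times> subgroup_generated G K \<cong> G"
proof -
  obtain K where K: "subgroup K G" "generate G {a} \<inter> K = {\<one>}" "generate G {a} <#> K = carrier G"
    using exists_complement[OF assms] by auto
  have sa: "subgroup (generate G {a}) G" using a by (intro generate_is_subgroup) auto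
  interpret gd: group_disjoint_sum G "generate G {a}" K
    using sa K(1) by (simp add: group_disjoint_sum_def is_group)
  have 1: "subgroup_generated G (generate G {a}) \<times>\<times> subgroup_generated G K \<cong> G"
    using gd.iso_group_mul[OF comm_group_axioms] K by (auto simp: is_iso_def)
  let ?C = "subgroup_generated G (generate G {a})"
  have cC: "carrier ?C = generate G {a}" using sa by (rule subgroup.carrier_subgroup_generated_subgroup)
  interpret C: group ?C by simp
  have aC: "a \<in> carrier ?C" unfolding cC by (rule generate.incl) simp
  have pow: "a [^]\<^bsub>?C\<^esub> n = a [^] n" for n :: nat by (induction n) auto
  have "C.ord a = ord a"
    using aC a by (subst C.ord_unique) (simp_all add: pow pow_eq_id)
  moreover have "order ?C = ord a" using generate_pow_card[OF a] by (simp add: order_def cC)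
  moreover have "finite (carrier ?C)" using fin subgroup.subset[OF sa] by (simp add: cC finite_subset)
  ultimately have "integer_mod_group (ord a) \<cong> ?C" using C.iso_integer_mod_group aC by metis
  then have "integer_mod_group (ord a) \<times>\<times> subgroup_generated G K \<cong> ?C \<times>\<times> subgroup_generated G K"
    by (intro group.DirProd_iso_trans iso_refl) simp
  from iso_trans[OF this 1] show ?thesis using abelian_subgroup_generated[OF comm_group_axioms] by blast
qed

text \<open>The counts determine the order of the group and then its exponent, which is the order of
  the cyclic factor split off. Torsion counts of a direct product multiply, so the factor
  \<open>gcd d (G.ord a)\<close> of the cyclic part cancels and the complements satisfy the
  hypothesis again.\<close>

theorem iso_if_card_torsion_eq:
  assumes "comm_group G" "comm_group H" "finite (carrier G)" "finite (carrier H)"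
    and "\<And>d. d > 0 \<Longrightarrow> card (torsion G d) = card (torsion H d)"
  shows "G \<cong> H"
  using assms
proof (induction "order G" arbitrary: G H rule: less_induct)
  case less
  interpret G: comm_group G by fact
  interpret H: comm_group H by fact
  have posG: "order G > 0" and posH: "order H > 0"
    using less.prems G.order_gt_0_iff_finite H.order_gt_0_iff_finite by auto
  \<comment> \<open>One positive exponent that annihilates both groups, so that comparing the counts
    there compares the orders.\<close>
  have all: "torsion G (order G * order H) = carrier G" "torsion H (order G * order H) = carrier H"
    using G.pow_order_eq_1 H.pow_order_eq_1
    by (auto simp: torsion_def G.pow_eq_id H.pow_eq_id G.ord_dvd_group_order H.ord_dvd_group_order)
  then have ord_eq: "order G = order H"
    using less.prems(5)[of "order G * order H"] posG posH by (simp add: order_def)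
  obtain a where a: "a \<in> carrier G" "\<And>x. x \<in> carrier G \<Longrightarrow> G.ord x dvd G.ord a"
    using G.exists_exponent_element less.prems by blast
  obtain b where b: "b \<in> carrier H" "\<And>x. x \<in> carrier H \<Longrightarrow> H.ord x dvd H.ord b"
    using H.exists_exponent_element less.prems by blast
  have pos: "G.ord a > 0" "H.ord b > 0"
    using G.ord_ge_1[OF _ a(1)] H.ord_ge_1[OF _ b(1)] less.prems by auto
  have tG: "torsion G d = carrier G \<longleftrightarrow> G.ord a dvd d" for d
  proof
    assume "torsion G d = carrier G"
    then show "G.ord a dvd d" using a(1) by (auto simp: torsion_def G.pow_eq_id[symmetric])
  next
    assume "G.ord a dvd d"
    then show "torsion G d = carrier G" using a(2) G.pow_eq_id by (auto simp: torsion_def intro: dvd_trans)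
  qed
  have tH: "torsion H d = carrier H \<longleftrightarrow> H.ord b dvd d" for d
  proof
    assume "torsion H d = carrier H"
    then show "H.ord b dvd d" using b(1) by (auto simp: torsion_def H.pow_eq_id[symmetric])
  next
    assume "H.ord b dvd d"
    then show "torsion H d = carrier H" using b(2) H.pow_eq_id by (auto simp: torsion_def intro: dvd_trans)
  qed
  \<comment> \<open>With equal orders, the cardinality alone tells whether d annihilates the group.
    So both groups are annihilated by the same d, and the maximal orders divide each other.\<close>
  have full: "torsion G d = carrier G \<longleftrightarrow> torsion H d = carrier H" if "d > 0" for d
  proof -
    have "torsion G d = carrier G \<longleftrightarrow> card (torsion G d) = order G"
      using less.prems(3) unfolding order_def
      by (metis (no_types, lifting) card_subset_eq mem_Collect_eq subsetI torsion_def)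
    moreover have "torsion H d = carrier H \<longleftrightarrow> card (torsion H d) = order H"
      using less.prems(4) unfolding order_def
      by (metis (no_types, lifting) card_subset_eq mem_Collect_eq subsetI torsion_def)
    ultimately show ?thesis using less.prems(5)[OF that] ord_eq by simp
  qed
  have N: "G.ord a = H.ord b"
    using full pos tG tH by (meson dvd_antisym dvd_refl)
  show ?case
  proof (cases "G.ord a = 1")
    case True
    then have "carrier G = {\<one>\<^bsub>G\<^esub>}" using a(2) G.ord_eq_1 by (auto simp: dvd_1_iff_1)
    then have o: "order G = 1" by (simp add: order_def)
    then have "integer_mod_group 1 \<cong> G" "integer_mod_group 1 \<cong> H"
      using G.iso_integer_mod_group[of "\<one>\<^bsub>G\<^esub>"] H.iso_integer_mod_group[of "\<one>\<^bsub>H\<^esub>"] less.prems ord_eq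
      by simp_all
    then show ?thesis by (meson group.iso_sym group_integer_mod_group iso_trans)
  next
    case False
    obtain K where K: "comm_group (subgroup_generated G K)"
        "integer_mod_group (G.ord a) \<times>\<times> subgroup_generated G K \<cong> G"
      using G.exists_cyclic_splitting[OF less.prems(3) a] by blast
    obtain L where L: "comm_group (subgroup_generated H L)"
        "integer_mod_group (G.ord a) \<times>\<times> subgroup_generated H L \<cong> H"
      using H.exists_cyclic_splitting[OF less.prems(4) b] unfolding N by blast
    let ?K = "subgroup_generated G K" and ?L = "subgroup_generated H L"
    have finK: "finite (carrier ?K)" and finL: "finite (carrier ?L)"
      using less.prems G.carrier_subgroup_generated_subset H.carrier_subgroup_generated_subset
      by (meson finite_subset)+
    have grp: "group (integer_mod_group (G.ord a) \<times>\<times> ?K)" "group (integer_mod_group (G.ord a) \<times>\<times> ?L)"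
      by (simp_all add: DirProd_group)
    have "order G = G.ord a * order ?K"
      using iso_same_card[OF K(2)] order_integer_mod_group[of "G.ord a"]
      by (simp add: order_def card_cartesian_product)
    moreover have "order ?K > 0" using finK monoid.order_gt_0_iff_finite[of ?K] group.is_monoid[of ?K] by simp
    ultimately have "order ?K < order G" using False pos by (cases "G.ord a") auto
    moreover have "card (torsion ?K d) = card (torsion ?L d)" if "d > 0" for d
    proof -
      \<comment> \<open>Both products have the counts of \<open>G\<close> and \<open>H\<close>,
        which agree; the common factor is positive and cancels.\<close>
      have "gcd d (G.ord a) * card (torsion ?K d) = gcd d (G.ord a) * card (torsion ?L d)"
        using less.prems(5)[OF that] pos that
        card_torsion_iso[OF grp(1) G.is_group K(2), of d] card_torsion_iso[OF grp(2) H.is_group L(2), of d]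
        by (simp add: torsion_DirProd card_cartesian_product card_torsion_integer_mod_group)
      then show ?thesis using pos by simp
    qed
    ultimately have "?K \<cong> ?L" using less.hyps K(1) L(1) finK finL by blast
    then have "integer_mod_group (G.ord a) \<times>\<times> ?K \<cong> integer_mod_group (G.ord a) \<times>\<times> ?L"
      by (intro group.DirProd_iso_trans iso_refl) simp_all
    then show ?thesis using K(2) L(2) grp by (meson G.is_group group.iso_sym iso_trans)
  qed
qed

section \<open>Group algebras of finite abelian groups\<close>

lemma (in abelian_monoid) finsum_swap:
  assumes "finite A" "finite B" "\<And>i j. i \<in> A \<Longrightarrow> j \<in> B \<Longrightarrow> f i j \<in> carrier G"
  shows "(\<Oplus>i\<in>A. \<Oplus>j\<in>B. f i j) = (\<Oplus>j\<in>B. \<Oplus>i\<in>A. f i j)"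
  using assms(1,3)
proof (induction A)
  case empty
  then show ?case by simp
next
  case (insert a A)
  have "(\<Oplus>i\<in>insert a A. \<Oplus>j\<in>B. f i j) = (\<Oplus>j\<in>B. f a j) \<oplus> (\<Oplus>j\<in>B. \<Oplus>i\<in>A. f i j)"
    using insert by (subst finsum_insert) (auto simp: Pi_def intro!: finsum_closed)
  also have "\<dots> = (\<Oplus>j\<in>B. f a j \<oplus> (\<Oplus>i\<in>A. f i j))"
    using insert by (subst finsum_addf) (auto simp: Pi_def intro!: finsum_closed)
  also have "\<dots> = (\<Oplus>j\<in>B. \<Oplus>i\<in>insert a A. f i j)"
    using insert by (intro finsum_cong') (auto simp: Pi_def intro!: finsum_closed)
  finally show ?case .
qed

lemma (in abelian_monoid) finsum_Times:
  assumes "finite A" "finite B" "\<And>i j. i \<in> A \<Longrightarrow> j \<in> B \<Longrightarrow> f (i, j) \<in> carrier G"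
  shows "(\<Oplus>p\<in>A \<times> B. f p) = (\<Oplus>i\<in>A. \<Oplus>j\<in>B. f (i, j))"
  using assms(1,3)
proof (induction A)
  case empty
  then show ?case by simp
next
  case (insert a A)
  have "(\<Oplus>p\<in>insert a A \<times> B. f p) = (\<Oplus>p\<in>Pair a ` B \<union> A \<times> B. f p)"
    by (rule arg_cong[of _ _ "finsum G f"]) auto
  also have "\<dots> = (\<Oplus>p\<in>Pair a ` B. f p) \<oplus> (\<Oplus>p\<in>A \<times> B. f p)"
    using insert assms(2) by (intro finsum_Un_disjoint) auto
  also have "(\<Oplus>p\<in>Pair a ` B. f p) = (\<Oplus>j\<in>B. f (a, j))"
    using insert by (subst finsum_reindex) (auto simp: inj_on_def)
  also have "(\<Oplus>p\<in>A \<times> B. f p) = (\<Oplus>i\<in>A. \<Oplus>j\<in>B. f (i, j))"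
    using insert by simp
  also have "(\<Oplus>j\<in>B. f (a, j)) \<oplus> (\<Oplus>i\<in>A. \<Oplus>j\<in>B. f (i, j)) = (\<Oplus>i\<in>insert a A. \<Oplus>j\<in>B. f (i, j))"
    using insert by (subst finsum_insert) (auto simp: Pi_def intro!: finsum_closed)
  finally show ?case .
qed

lemma (in abelian_monoid) finsum_delta:
  assumes "finite A" "i \<in> A" "a \<in> carrier G"
  shows "(\<Oplus>j\<in>A. if j = i then a else \<zero>) = a"
  using add.finprod_singleton[of i A "\<lambda>_. a"] assms by (simp add: eq_commute)

text \<open>These are the two substitutions made in convolution sums: translation for the product
  formula, and y replaced by y^(-1) x for commutativity.\<close>

lemma (in group) reindex_mult_inv:
  assumes "x \<in> carrier G"
  shows "inj_on (\<lambda>y. x \<otimes> y) (carrier G)" "(\<lambda>y. x \<otimes> y) ` carrier G = carrier G"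
    "inj_on (\<lambda>y. inv y \<otimes> x) (carrier G)" "(\<lambda>y. inv y \<otimes> x) ` carrier G = carrier G"
proof -
  show "inj_on (\<lambda>y. x \<otimes> y) (carrier G)" using assms by (auto simp: inj_on_def)
  show "inj_on (\<lambda>y. inv y \<otimes> x) (carrier G)" using assms by (auto simp: inj_on_def)
  have "y = x \<otimes> (inv x \<otimes> y)" if "y \<in> carrier G" for y using assms that by (simp flip: m_assoc)
  then show "(\<lambda>y. x \<otimes> y) ` carrier G = carrier G" using assms by (auto simp: image_iff)
  have "y = inv (x \<otimes> inv y) \<otimes> x" if "y \<in> carrier G" for y
    using assms that by (simp add: inv_mult_group m_assoc)
  then show "(\<lambda>y. inv y \<otimes> x) ` carrier G = carrier G" using assms by (auto simp: image_iff)
qed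

section \<open>The group algebra of a finite abelian group as a commutative ring\<close>

locale finite_group_algebra = R: cring R + G: comm_group G
  for R (structure) and G +
  assumes finite_G: "finite (carrier G)"
begin

abbreviation A where "A \<equiv> group_algebra R G"

lemma carrier_A: "carrier A = (carrier G \<rightarrow>\<^sub>E carrier R)"
  using finite_G by (auto simp: group_algebra_def support_def)

lemma A_apply: "f \<in> carrier A \<Longrightarrow> x \<in> carrier G \<Longrightarrow> f x \<in> carrier R"
  by (auto simp: carrier_A)

lemma A_eqI:
  assumes "f \<in> carrier A" "g \<in> carrier A" "\<And>x. x \<in> carrier G \<Longrightarrow> f x = g x"
  shows "f = g"
  using assms unfolding carrier_A by (rule PiE_ext)

lemma zero_A: "\<zero>\<^bsub>A\<^esub> = (\<lambda>x\<in>carrier G. \<zero>)"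
  and one_A: "\<one>\<^bsub>A\<^esub> = (\<lambda>x\<in>carrier G. if x = \<one>\<^bsub>G\<^esub> then \<one> else \<zero>)"
  and add_A: "f \<oplus>\<^bsub>A\<^esub> g = (\<lambda>x\<in>carrier G. f x \<oplus> g x)"
  by (simp_all add: group_algebra_def)

text \<open>Summands outside the support vanish. A sum over the whole group, unlike one over a
  support, can be reindexed by translations.\<close>

lemma mult_A_apply:
  assumes f: "f \<in> carrier A" and g: "g \<in> carrier A" and x: "x \<in> carrier G"
  shows "(f \<otimes>\<^bsub>A\<^esub> g) x = (\<Oplus>y\<in>carrier G. f y \<otimes> g (inv\<^bsub>G\<^esub> y \<otimes>\<^bsub>G\<^esub> x))"
proof -
  have "(f \<otimes>\<^bsub>A\<^esub> g) x = (\<Oplus>y\<in>support R G f. f y \<otimes> g (inv\<^bsub>G\<^esub> y \<otimes>\<^bsub>G\<^esub> x))"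
    using x by (simp add: group_algebra_def)
  also have "\<dots> = (\<Oplus>y\<in>carrier G. f y \<otimes> g (inv\<^bsub>G\<^esub> y \<otimes>\<^bsub>G\<^esub> x))"
    using assms finite_G
    by (intro R.add.finprod_mono_neutral_cong_left) (auto simp: support_def A_apply)
  finally show ?thesis .
qed

lemma mult_A_closed: "f \<in> carrier A \<Longrightarrow> g \<in> carrier A \<Longrightarrow> f \<otimes>\<^bsub>A\<^esub> g \<in> carrier A"
  unfolding carrier_A
proof (rule PiE_I)
  fix x assume fg: "f \<in> carrier G \<rightarrow>\<^sub>E carrier R" "g \<in> carrier G \<rightarrow>\<^sub>E carrier R" and x: "x \<in> carrier G"
  then show "(f \<otimes>\<^bsub>A\<^esub> g) x \<in> carrier R"
    using fg x by (subst mult_A_apply) (auto simp: carrier_A intro!: R.finsum_closed R.m_closed)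
qed (auto simp: group_algebra_def)

text \<open>Exchange the two sums and substitute x = y z. With \<open>h\<close> the identity and
  \<open>\<phi>\<close> a translate of a third factor this yields associativity; with
  \<open>\<phi>\<close> a character it yields multiplicativity of evaluation.\<close>

lemma finsum_mult_A:
  assumes hom: "ring_hom_cring R S h" and f: "f \<in> carrier A" and g: "g \<in> carrier A"
    and \<phi>: "\<And>x. x \<in> carrier G \<Longrightarrow> \<phi> x \<in> carrier S"
  shows "(\<Oplus>\<^bsub>S\<^esub>x\<in>carrier G. h ((f \<otimes>\<^bsub>A\<^esub> g) x) \<otimes>\<^bsub>S\<^esub> \<phi> x) =
    (\<Oplus>\<^bsub>S\<^esub>y\<in>carrier G. \<Oplus>\<^bsub>S\<^esub>z\<in>carrier G. h (f y) \<otimes>\<^bsub>S\<^esub> h (g z) \<otimes>\<^bsub>S\<^esub> \<phi> (y \<otimes>\<^bsub>G\<^esub> z))"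
proof -
  interpret ring_hom_cring R S h by (rule hom)
  have fc: "h (f y) \<in> carrier S" and gc: "h (g y) \<in> carrier S" if "y \<in> carrier G" for y
    using f g that by (simp_all add: A_apply)
  have "h ((f \<otimes>\<^bsub>A\<^esub> g) x) \<otimes>\<^bsub>S\<^esub> \<phi> x =
      (\<Oplus>\<^bsub>S\<^esub>y\<in>carrier G. h (f y) \<otimes>\<^bsub>S\<^esub> h (g (inv\<^bsub>G\<^esub> y \<otimes>\<^bsub>G\<^esub> x)) \<otimes>\<^bsub>S\<^esub> \<phi> x)" if x: "x \<in> carrier G" for x
  proof -
    have "h ((f \<otimes>\<^bsub>A\<^esub> g) x) = (\<Oplus>\<^bsub>S\<^esub>y\<in>carrier G. h (f y) \<otimes>\<^bsub>S\<^esub> h (g (inv\<^bsub>G\<^esub> y \<otimes>\<^bsub>G\<^esub> x)))"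
      using x f g
      by (simp add: mult_A_apply hom_finsum A_apply Pi_def o_def cong: S.finsum_cong')
        (intro S.finsum_cong', auto simp: A_apply)
    then show ?thesis using fc gc \<phi> x finite_G by (simp add: S.finsum_ldistr Pi_def)
  qed
  then have "(\<Oplus>\<^bsub>S\<^esub>x\<in>carrier G. h ((f \<otimes>\<^bsub>A\<^esub> g) x) \<otimes>\<^bsub>S\<^esub> \<phi> x) =
    (\<Oplus>\<^bsub>S\<^esub>x\<in>carrier G. \<Oplus>\<^bsub>S\<^esub>y\<in>carrier G. h (f y) \<otimes>\<^bsub>S\<^esub> h (g (inv\<^bsub>G\<^esub> y \<otimes>\<^bsub>G\<^esub> x)) \<otimes>\<^bsub>S\<^esub> \<phi> x)"
    using fc gc \<phi> by (intro S.finsum_cong') (auto intro!: S.finsum_closed)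
  also have "\<dots> = (\<Oplus>\<^bsub>S\<^esub>y\<in>carrier G. \<Oplus>\<^bsub>S\<^esub>x\<in>carrier G. h (f y) \<otimes>\<^bsub>S\<^esub> h (g (inv\<^bsub>G\<^esub> y \<otimes>\<^bsub>G\<^esub> x)) \<otimes>\<^bsub>S\<^esub> \<phi> x)"
    using fc gc \<phi> finite_G by (intro S.finsum_swap) auto
  also have "\<dots> = (\<Oplus>\<^bsub>S\<^esub>y\<in>carrier G. \<Oplus>\<^bsub>S\<^esub>z\<in>carrier G. h (f y) \<otimes>\<^bsub>S\<^esub> h (g z) \<otimes>\<^bsub>S\<^esub> \<phi> (y \<otimes>\<^bsub>G\<^esub> z))"
  proof (rule S.finsum_cong')
    fix y assume y: "y \<in> carrier G"
    have "(\<Oplus>\<^bsub>S\<^esub>x\<in>carrier G. h (f y) \<otimes>\<^bsub>S\<^esub> h (g (inv\<^bsub>G\<^esub> y \<otimes>\<^bsub>G\<^esub> x)) \<otimes>\<^bsub>S\<^esub> \<phi> x) =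
      (\<Oplus>\<^bsub>S\<^esub>x\<in>(\<lambda>z. y \<otimes>\<^bsub>G\<^esub> z) ` carrier G. h (f y) \<otimes>\<^bsub>S\<^esub> h (g (inv\<^bsub>G\<^esub> y \<otimes>\<^bsub>G\<^esub> x)) \<otimes>\<^bsub>S\<^esub> \<phi> x)"
      using G.reindex_mult_inv(2)[OF y] by simp
    also have "\<dots> = (\<Oplus>\<^bsub>S\<^esub>z\<in>carrier G. h (f y) \<otimes>\<^bsub>S\<^esub> h (g (inv\<^bsub>G\<^esub> y \<otimes>\<^bsub>G\<^esub> (y \<otimes>\<^bsub>G\<^esub> z))) \<otimes>\<^bsub>S\<^esub> \<phi> (y \<otimes>\<^bsub>G\<^esub> z))"
      using fc gc \<phi> y G.reindex_mult_inv(1)[OF y] by (intro S.finsum_reindex) auto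
    also have "\<dots> = (\<Oplus>\<^bsub>S\<^esub>z\<in>carrier G. h (f y) \<otimes>\<^bsub>S\<^esub> h (g z) \<otimes>\<^bsub>S\<^esub> \<phi> (y \<otimes>\<^bsub>G\<^esub> z))"
      using fc gc \<phi> y by (intro S.finsum_cong') (auto simp flip: G.m_assoc)
    finally show "(\<Oplus>\<^bsub>S\<^esub>x\<in>carrier G. h (f y) \<otimes>\<^bsub>S\<^esub> h (g (inv\<^bsub>G\<^esub> y \<otimes>\<^bsub>G\<^esub> x)) \<otimes>\<^bsub>S\<^esub> \<phi> x) =
      (\<Oplus>\<^bsub>S\<^esub>z\<in>carrier G. h (f y) \<otimes>\<^bsub>S\<^esub> h (g z) \<otimes>\<^bsub>S\<^esub> \<phi> (y \<otimes>\<^bsub>G\<^esub> z))" .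
  qed (use fc gc \<phi> in \<open>auto intro!: S.finsum_closed\<close>)
  finally show ?thesis .
qed

lemma ring_hom_cring_id: "ring_hom_cring R R (\<lambda>x. x)"
  by (intro ring_hom_cringI ring_hom_memI) (auto simp: R.is_cring)

lemma mult_A_comm:
  assumes "f \<in> carrier A" "g \<in> carrier A"
  shows "f \<otimes>\<^bsub>A\<^esub> g = g \<otimes>\<^bsub>A\<^esub> f"
proof (rule A_eqI)
  fix x assume x: "x \<in> carrier G"
  \<comment> \<open>The substitution y = z^(-1) x exchanges the two arguments y and y^(-1) x of the
    convolution.\<close>
  have "(f \<otimes>\<^bsub>A\<^esub> g) x = (\<Oplus>y\<in>(\<lambda>z. inv\<^bsub>G\<^esub> z \<otimes>\<^bsub>G\<^esub> x) ` carrier G. f y \<otimes> g (inv\<^bsub>G\<^esub> y \<otimes>\<^bsub>G\<^esub> x))"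
    using G.reindex_mult_inv(4)[OF x] assms x by (simp add: mult_A_apply)
  also have "\<dots> = (\<Oplus>z\<in>carrier G. f (inv\<^bsub>G\<^esub> z \<otimes>\<^bsub>G\<^esub> x) \<otimes> g (inv\<^bsub>G\<^esub> (inv\<^bsub>G\<^esub> z \<otimes>\<^bsub>G\<^esub> x) \<otimes>\<^bsub>G\<^esub> x))"
    using assms x G.reindex_mult_inv(3)[OF x] by (intro R.finsum_reindex) (auto simp: A_apply)
  also have "\<dots> = (\<Oplus>z\<in>carrier G. g z \<otimes> f (inv\<^bsub>G\<^esub> z \<otimes>\<^bsub>G\<^esub> x))"
  proof (rule R.finsum_cong')
    fix z assume z: "z \<in> carrier G"
    have "inv\<^bsub>G\<^esub> (inv\<^bsub>G\<^esub> z \<otimes>\<^bsub>G\<^esub> x) = z \<otimes>\<^bsub>G\<^esub> inv\<^bsub>G\<^esub> x"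
      using x z by (simp add: G.inv_mult_group G.m_comm)
    then have "inv\<^bsub>G\<^esub> (inv\<^bsub>G\<^esub> z \<otimes>\<^bsub>G\<^esub> x) \<otimes>\<^bsub>G\<^esub> x = z" using x z by (simp add: G.m_assoc)
    then show "f (inv\<^bsub>G\<^esub> z \<otimes>\<^bsub>G\<^esub> x) \<otimes> g (inv\<^bsub>G\<^esub> (inv\<^bsub>G\<^esub> z \<otimes>\<^bsub>G\<^esub> x) \<otimes>\<^bsub>G\<^esub> x) = g z \<otimes> f (inv\<^bsub>G\<^esub> z \<otimes>\<^bsub>G\<^esub> x)"
      using assms x z by (simp add: R.m_comm A_apply)
  qed (use assms x in \<open>auto simp: A_apply\<close>)
  also have "\<dots> = (g \<otimes>\<^bsub>A\<^esub> f) x" using assms x by (simp add: mult_A_apply)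
  finally show "(f \<otimes>\<^bsub>A\<^esub> g) x = (g \<otimes>\<^bsub>A\<^esub> f) x" .
qed (use assms mult_A_closed in auto)

lemma mult_A_assoc:
  assumes f: "f \<in> carrier A" and g: "g \<in> carrier A" and k: "k \<in> carrier A"
  shows "f \<otimes>\<^bsub>A\<^esub> g \<otimes>\<^bsub>A\<^esub> k = f \<otimes>\<^bsub>A\<^esub> (g \<otimes>\<^bsub>A\<^esub> k)"
proof (rule A_eqI)
  fix x assume x: "x \<in> carrier G"
  note closed = A_apply[OF f] A_apply[OF g] A_apply[OF k]
  have "(f \<otimes>\<^bsub>A\<^esub> g \<otimes>\<^bsub>A\<^esub> k) x = (\<Oplus>y\<in>carrier G. (f \<otimes>\<^bsub>A\<^esub> g) y \<otimes> k (inv\<^bsub>G\<^esub> y \<otimes>\<^bsub>G\<^esub> x))"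
    using assms x by (intro mult_A_apply mult_A_closed)
  also have "\<dots> = (\<Oplus>y\<in>carrier G. \<Oplus>z\<in>carrier G. f y \<otimes> g z \<otimes> k (inv\<^bsub>G\<^esub> (y \<otimes>\<^bsub>G\<^esub> z) \<otimes>\<^bsub>G\<^esub> x))"
    using closed x by (intro finsum_mult_A[OF ring_hom_cring_id f g]) auto
  also have "\<dots> = (\<Oplus>y\<in>carrier G. f y \<otimes> (g \<otimes>\<^bsub>A\<^esub> k) (inv\<^bsub>G\<^esub> y \<otimes>\<^bsub>G\<^esub> x))"
  proof (rule R.finsum_cong')
    fix y assume y: "y \<in> carrier G"
    have "f y \<otimes> (g \<otimes>\<^bsub>A\<^esub> k) (inv\<^bsub>G\<^esub> y \<otimes>\<^bsub>G\<^esub> x) =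
      f y \<otimes> (\<Oplus>z\<in>carrier G. g z \<otimes> k (inv\<^bsub>G\<^esub> z \<otimes>\<^bsub>G\<^esub> (inv\<^bsub>G\<^esub> y \<otimes>\<^bsub>G\<^esub> x)))"
      using g k x y by (simp add: mult_A_apply)
    also have "\<dots> = (\<Oplus>z\<in>carrier G. f y \<otimes> (g z \<otimes> k (inv\<^bsub>G\<^esub> z \<otimes>\<^bsub>G\<^esub> (inv\<^bsub>G\<^esub> y \<otimes>\<^bsub>G\<^esub> x))))"
      using closed x y finite_G by (intro R.finsum_rdistr) auto
    also have "\<dots> = (\<Oplus>z\<in>carrier G. f y \<otimes> g z \<otimes> k (inv\<^bsub>G\<^esub> (y \<otimes>\<^bsub>G\<^esub> z) \<otimes>\<^bsub>G\<^esub> x))"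
      using closed x y by (intro R.finsum_cong') (auto simp: R.m_assoc G.m_assoc G.inv_mult_group)
    finally show "(\<Oplus>z\<in>carrier G. f y \<otimes> g z \<otimes> k (inv\<^bsub>G\<^esub> (y \<otimes>\<^bsub>G\<^esub> z) \<otimes>\<^bsub>G\<^esub> x)) =
      f y \<otimes> (g \<otimes>\<^bsub>A\<^esub> k) (inv\<^bsub>G\<^esub> y \<otimes>\<^bsub>G\<^esub> x)" by simp
  qed (use assms closed x in \<open>auto simp: A_apply mult_A_closed\<close>)
  also have "\<dots> = (f \<otimes>\<^bsub>A\<^esub> (g \<otimes>\<^bsub>A\<^esub> k)) x"
    using assms x by (simp add: mult_A_apply mult_A_closed)
  finally show "(f \<otimes>\<^bsub>A\<^esub> g \<otimes>\<^bsub>A\<^esub> k) x = (f \<otimes>\<^bsub>A\<^esub> (g \<otimes>\<^bsub>A\<^esub> k)) x" .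
qed (use assms mult_A_closed in auto)

text \<open>The monomial \<open>a x\<close> of the formal sums; for x = 1 these are the constants, a
  copy of \<open>R\<close> in the algebra.\<close>

definition single :: "'c \<Rightarrow> 'a \<Rightarrow> 'c \<Rightarrow> 'a" where
  "single x a = (\<lambda>y\<in>carrier G. if y = x then a else \<zero>)"

lemma single_closed: "a \<in> carrier R \<Longrightarrow> single x a \<in> carrier A"
  by (auto simp: single_def carrier_A)

lemma single_mult_apply:
  assumes "x \<in> carrier G" "a \<in> carrier R" "f \<in> carrier A" "y \<in> carrier G"
  shows "(single x a \<otimes>\<^bsub>A\<^esub> f) y = a \<otimes> f (inv\<^bsub>G\<^esub> x \<otimes>\<^bsub>G\<^esub> y)"
proof -
  have "(single x a \<otimes>\<^bsub>A\<^esub> f) y = (\<Oplus>z\<in>carrier G. single x a z \<otimes> f (inv\<^bsub>G\<^esub> z \<otimes>\<^bsub>G\<^esub> y))"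
    using assms by (simp add: mult_A_apply single_closed)
  also have "\<dots> = (\<Oplus>z\<in>carrier G. if z = x then a \<otimes> f (inv\<^bsub>G\<^esub> x \<otimes>\<^bsub>G\<^esub> y) else \<zero>)"
    using assms by (intro R.finsum_cong') (auto simp: single_def A_apply)
  also have "\<dots> = a \<otimes> f (inv\<^bsub>G\<^esub> x \<otimes>\<^bsub>G\<^esub> y)"
    using assms finite_G by (intro R.finsum_delta) (auto simp: A_apply)
  finally show ?thesis .
qed

lemma one_A_eq_single: "\<one>\<^bsub>A\<^esub> = single \<one>\<^bsub>G\<^esub> \<one>"
  by (simp add: one_A single_def)

lemma cring_A: "cring A"
proof (rule cringI)
  have inv: "\<exists>g\<in>carrier A. g \<oplus>\<^bsub>A\<^esub> f = \<zero>\<^bsub>A\<^esub>" if "f \<in> carrier A" for f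
    using that
    by (intro bexI[of _ "\<lambda>x\<in>carrier G. \<ominus> f x"])
      (auto simp: add_A zero_A carrier_A R.l_neg fun_eq_iff PiE_iff)
  show "abelian_group A"
    by (rule abelian_groupI)
      (use inv in \<open>auto simp: add_A zero_A carrier_A fun_eq_iff PiE_iff R.a_ac extensional_def\<close>)
  show "comm_monoid A"
  proof (rule comm_monoidI)
    fix f assume f: "f \<in> carrier A"
    show "\<one>\<^bsub>A\<^esub> \<otimes>\<^bsub>A\<^esub> f = f"
      using f by (intro A_eqI) (auto simp: one_A_eq_single mult_A_closed single_closed single_mult_apply A_apply)
  qed (use mult_A_closed mult_A_assoc mult_A_comm in \<open>simp_all add: one_A_eq_single single_closed\<close>)
  fix f g k assume fgk: "f \<in> carrier A" "g \<in> carrier A" "k \<in> carrier A"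
  have add: "f \<oplus>\<^bsub>A\<^esub> g \<in> carrier A" if "f \<in> carrier A" "g \<in> carrier A" for f g
    using that by (auto simp: add_A carrier_A)
  show "(f \<oplus>\<^bsub>A\<^esub> g) \<otimes>\<^bsub>A\<^esub> k = f \<otimes>\<^bsub>A\<^esub> k \<oplus>\<^bsub>A\<^esub> g \<otimes>\<^bsub>A\<^esub> k"
  proof (rule A_eqI)
    fix x assume x: "x \<in> carrier G"
    have "((f \<oplus>\<^bsub>A\<^esub> g) \<otimes>\<^bsub>A\<^esub> k) x =
      (\<Oplus>y\<in>carrier G. f y \<otimes> k (inv\<^bsub>G\<^esub> y \<otimes>\<^bsub>G\<^esub> x) \<oplus> g y \<otimes> k (inv\<^bsub>G\<^esub> y \<otimes>\<^bsub>G\<^esub> x))"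
      unfolding mult_A_apply[OF add[OF fgk(1,2)] fgk(3) x]
      using fgk x by (intro R.finsum_cong') (auto simp: add_A A_apply R.l_distr)
    also have "\<dots> = (f \<otimes>\<^bsub>A\<^esub> k) x \<oplus> (g \<otimes>\<^bsub>A\<^esub> k) x"
      using fgk x by (subst R.finsum_addf) (auto simp: A_apply mult_A_apply)
    finally show "((f \<oplus>\<^bsub>A\<^esub> g) \<otimes>\<^bsub>A\<^esub> k) x = (f \<otimes>\<^bsub>A\<^esub> k \<oplus>\<^bsub>A\<^esub> g \<otimes>\<^bsub>A\<^esub> k) x"
      using x by (simp add: add_A)
  qed (use fgk add mult_A_closed in auto)
qed

sublocale A: cring A by (rule cring_A)

text \<open>The linear extension of a character is multiplicative because the double sum for a
  product separates into two factors. It provides both the augmentation and the evaluations in the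
  quadratic extension.\<close>

lemma ring_hom_evaluation:
  assumes hom: "ring_hom_cring R S h"
    and \<chi>: "\<And>x. x \<in> carrier G \<Longrightarrow> \<chi> x \<in> carrier S" "\<chi> \<one>\<^bsub>G\<^esub> = \<one>\<^bsub>S\<^esub>"
      "\<And>x y. x \<in> carrier G \<Longrightarrow> y \<in> carrier G \<Longrightarrow> \<chi> (x \<otimes>\<^bsub>G\<^esub> y) = \<chi> x \<otimes>\<^bsub>S\<^esub> \<chi> y"
  shows "(\<lambda>f. \<Oplus>\<^bsub>S\<^esub>x\<in>carrier G. h (f x) \<otimes>\<^bsub>S\<^esub> \<chi> x) \<in> ring_hom A S"
proof (rule ring_hom_memI)
  interpret ring_hom_cring R S h by (rule hom)
  have hc: "h (f x) \<in> carrier S" if "f \<in> carrier A" "x \<in> carrier G" for f x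
    using that by (simp add: A_apply)
  fix f assume f: "f \<in> carrier A"
  show "(\<Oplus>\<^bsub>S\<^esub>x\<in>carrier G. h (f x) \<otimes>\<^bsub>S\<^esub> \<chi> x) \<in> carrier S"
    using hc f \<chi> by (auto intro!: S.finsum_closed)
  fix g assume g: "g \<in> carrier A"
  have "(\<Oplus>\<^bsub>S\<^esub>x\<in>carrier G. h ((f \<oplus>\<^bsub>A\<^esub> g) x) \<otimes>\<^bsub>S\<^esub> \<chi> x) =
    (\<Oplus>\<^bsub>S\<^esub>x\<in>carrier G. h (f x) \<otimes>\<^bsub>S\<^esub> \<chi> x \<oplus>\<^bsub>S\<^esub> h (g x) \<otimes>\<^bsub>S\<^esub> \<chi> x)"
    using f g hc \<chi> by (intro S.finsum_cong') (auto simp: add_A S.l_distr A_apply)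
  also have "\<dots> = (\<Oplus>\<^bsub>S\<^esub>x\<in>carrier G. h (f x) \<otimes>\<^bsub>S\<^esub> \<chi> x) \<oplus>\<^bsub>S\<^esub> (\<Oplus>\<^bsub>S\<^esub>x\<in>carrier G. h (g x) \<otimes>\<^bsub>S\<^esub> \<chi> x)"
    using f g hc \<chi> by (intro S.finsum_addf) auto
  finally show "(\<Oplus>\<^bsub>S\<^esub>x\<in>carrier G. h ((f \<oplus>\<^bsub>A\<^esub> g) x) \<otimes>\<^bsub>S\<^esub> \<chi> x) =
    (\<Oplus>\<^bsub>S\<^esub>x\<in>carrier G. h (f x) \<otimes>\<^bsub>S\<^esub> \<chi> x) \<oplus>\<^bsub>S\<^esub> (\<Oplus>\<^bsub>S\<^esub>x\<in>carrier G. h (g x) \<otimes>\<^bsub>S\<^esub> \<chi> x)" .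
  have "(\<Oplus>\<^bsub>S\<^esub>x\<in>carrier G. h ((f \<otimes>\<^bsub>A\<^esub> g) x) \<otimes>\<^bsub>S\<^esub> \<chi> x) =
    (\<Oplus>\<^bsub>S\<^esub>y\<in>carrier G. \<Oplus>\<^bsub>S\<^esub>z\<in>carrier G. h (f y) \<otimes>\<^bsub>S\<^esub> h (g z) \<otimes>\<^bsub>S\<^esub> \<chi> (y \<otimes>\<^bsub>G\<^esub> z))"
    using f g \<chi> by (intro finsum_mult_A[OF hom]) auto
  also have "\<dots> = (\<Oplus>\<^bsub>S\<^esub>y\<in>carrier G. (h (f y) \<otimes>\<^bsub>S\<^esub> \<chi> y) \<otimes>\<^bsub>S\<^esub> (\<Oplus>\<^bsub>S\<^esub>z\<in>carrier G. h (g z) \<otimes>\<^bsub>S\<^esub> \<chi> z))"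
  proof (rule S.finsum_cong')
    fix y assume y: "y \<in> carrier G"
    have "(h (f y) \<otimes>\<^bsub>S\<^esub> \<chi> y) \<otimes>\<^bsub>S\<^esub> (\<Oplus>\<^bsub>S\<^esub>z\<in>carrier G. h (g z) \<otimes>\<^bsub>S\<^esub> \<chi> z) =
      (\<Oplus>\<^bsub>S\<^esub>z\<in>carrier G. (h (f y) \<otimes>\<^bsub>S\<^esub> \<chi> y) \<otimes>\<^bsub>S\<^esub> (h (g z) \<otimes>\<^bsub>S\<^esub> \<chi> z))"
      using f g hc \<chi> y finite_G by (intro S.finsum_rdistr) auto
    also have "\<dots> = (\<Oplus>\<^bsub>S\<^esub>z\<in>carrier G. h (f y) \<otimes>\<^bsub>S\<^esub> h (g z) \<otimes>\<^bsub>S\<^esub> \<chi> (y \<otimes>\<^bsub>G\<^esub> z))"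
      using f g hc \<chi> y by (intro S.finsum_cong') (auto simp: S.m_ac)
    finally show "(\<Oplus>\<^bsub>S\<^esub>z\<in>carrier G. h (f y) \<otimes>\<^bsub>S\<^esub> h (g z) \<otimes>\<^bsub>S\<^esub> \<chi> (y \<otimes>\<^bsub>G\<^esub> z)) =
      (h (f y) \<otimes>\<^bsub>S\<^esub> \<chi> y) \<otimes>\<^bsub>S\<^esub> (\<Oplus>\<^bsub>S\<^esub>z\<in>carrier G. h (g z) \<otimes>\<^bsub>S\<^esub> \<chi> z)" by simp
  qed (use f g hc \<chi> in \<open>auto intro!: S.finsum_closed\<close>)
  also have "\<dots> = (\<Oplus>\<^bsub>S\<^esub>x\<in>carrier G. h (f x) \<otimes>\<^bsub>S\<^esub> \<chi> x) \<otimes>\<^bsub>S\<^esub> (\<Oplus>\<^bsub>S\<^esub>x\<in>carrier G. h (g x) \<otimes>\<^bsub>S\<^esub> \<chi> x)"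
    using f g hc \<chi> finite_G by (intro S.finsum_ldistr[symmetric]) (auto intro!: S.finsum_closed)
  finally show "(\<Oplus>\<^bsub>S\<^esub>x\<in>carrier G. h ((f \<otimes>\<^bsub>A\<^esub> g) x) \<otimes>\<^bsub>S\<^esub> \<chi> x) =
    (\<Oplus>\<^bsub>S\<^esub>x\<in>carrier G. h (f x) \<otimes>\<^bsub>S\<^esub> \<chi> x) \<otimes>\<^bsub>S\<^esub> (\<Oplus>\<^bsub>S\<^esub>x\<in>carrier G. h (g x) \<otimes>\<^bsub>S\<^esub> \<chi> x)" .
next
  interpret ring_hom_cring R S h by (rule hom)
  have "(\<Oplus>\<^bsub>S\<^esub>x\<in>carrier G. h (\<one>\<^bsub>A\<^esub> x) \<otimes>\<^bsub>S\<^esub> \<chi> x) = (\<Oplus>\<^bsub>S\<^esub>x\<in>carrier G. if x = \<one>\<^bsub>G\<^esub> then \<one>\<^bsub>S\<^esub> else \<zero>\<^bsub>S\<^esub>)"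
    using \<chi> by (intro S.finsum_cong') (auto simp: one_A)
  then show "(\<Oplus>\<^bsub>S\<^esub>x\<in>carrier G. h (\<one>\<^bsub>A\<^esub> x) \<otimes>\<^bsub>S\<^esub> \<chi> x) = \<one>\<^bsub>S\<^esub>"
    using finite_G by (simp add: S.finsum_delta)
qed

lemma single_mult_single:
  assumes "x \<in> carrier G" "a \<in> carrier R" "y \<in> carrier G" "b \<in> carrier R"
  shows "single x a \<otimes>\<^bsub>A\<^esub> single y b = single (x \<otimes>\<^bsub>G\<^esub> y) (a \<otimes> b)"
proof (rule A_eqI)
  fix z assume z: "z \<in> carrier G"
  have "inv\<^bsub>G\<^esub> x \<otimes>\<^bsub>G\<^esub> z = y \<longleftrightarrow> z = x \<otimes>\<^bsub>G\<^esub> y"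
    using assms z by (metis G.inv_solve_left)
  then show "(single x a \<otimes>\<^bsub>A\<^esub> single y b) z = single (x \<otimes>\<^bsub>G\<^esub> y) (a \<otimes> b) z"
    using assms z by (auto simp: single_mult_apply single_closed) (auto simp: single_def)
qed (use assms in \<open>auto simp: single_closed\<close>)

lemma single_pow:
  fixes k :: nat
  assumes "x \<in> carrier G" "a \<in> carrier R"
  shows "single x a [^]\<^bsub>A\<^esub> k = single (x [^]\<^bsub>G\<^esub> k) (a [^] k)"
  using assms by (induction k) (auto simp: single_mult_single one_A_eq_single)

lemma finsum_A_apply:
  assumes "finite I" "\<And>i. i \<in> I \<Longrightarrow> f i \<in> carrier A" "x \<in> carrier G"
  shows "(\<Oplus>\<^bsub>A\<^esub>i\<in>I. f i) x = (\<Oplus>i\<in>I. f i x)"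
  using assms(1,2)
proof (induction I)
  case empty
  then show ?case using assms(3) by (simp add: zero_A)
next
  case (insert j I)
  then have "(\<Oplus>\<^bsub>A\<^esub>i\<in>insert j I. f i) x = (f j \<oplus>\<^bsub>A\<^esub> (\<Oplus>\<^bsub>A\<^esub>i\<in>I. f i)) x"
    by (subst A.finsum_insert) (auto simp: Pi_def)
  also have "\<dots> = f j x \<oplus> (\<Oplus>i\<in>I. f i x)" using insert assms(3) by (simp add: add_A)
  also have "\<dots> = (\<Oplus>i\<in>insert j I. f i x)"
    using insert assms(3) by (subst R.finsum_insert) (auto simp: A_apply)
  finally show ?case .
qed

text \<open>Makes the additivity of Frobenius applicable to an arbitrary element of the
  algebra.\<close>

lemma eq_finsum_single:
  assumes "f \<in> carrier A"
  shows "f = (\<Oplus>\<^bsub>A\<^esub>x\<in>carrier G. single x (f x))"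
proof (rule A_eqI)
  fix y assume y: "y \<in> carrier G"
  have "(\<Oplus>\<^bsub>A\<^esub>x\<in>carrier G. single x (f x)) y = (\<Oplus>x\<in>carrier G. single x (f x) y)"
    using assms y finite_G by (intro finsum_A_apply) (auto simp: single_closed A_apply)
  also have "\<dots> = (\<Oplus>x\<in>carrier G. if x = y then f y else \<zero>)"
    using assms y by (intro R.finsum_cong') (auto simp: single_def A_apply)
  also have "\<dots> = f y" using assms y finite_G by (intro R.finsum_delta) (auto simp: A_apply)
  finally show "f y = (\<Oplus>\<^bsub>A\<^esub>x\<in>carrier G. single x (f x)) y" by simp
qed (use assms in \<open>auto intro!: A.finsum_closed simp: single_closed A_apply\<close>)

end

section \<open>Characteristic 2\<close>

text \<open>Iterated Frobenius: the cross terms u v + u v of a square cancel, and the 2^k-th power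
  is a k-fold squaring.\<close>

lemma (in cring) two_power_add_char_2:
  assumes "\<one> \<oplus> \<one> = \<zero>" "x \<in> carrier R" "y \<in> carrier R"
  shows "(x \<oplus> y) [^] (2 ^ k :: nat) = x [^] (2 ^ k :: nat) \<oplus> y [^] (2 ^ k :: nat)"
proof (induction k)
  case 0
  then show ?case using assms by simp
next
  case (Suc k)
  have double: "z \<oplus> z = \<zero>" if "z \<in> carrier R" for z
    using that assms(1) by (metis l_distr l_null l_one one_closed)
  have sq: "(u \<oplus> v) [^] (2::nat) = u [^] (2::nat) \<oplus> v [^] (2::nat)" if "u \<in> carrier R" "v \<in> carrier R" for u v
  proof -
    have "(u \<oplus> v) [^] (2::nat) = u \<otimes> u \<oplus> v \<otimes> v \<oplus> (u \<otimes> v \<oplus> u \<otimes> v)"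
      using that by (simp add: numeral_2_eq_2 l_distr r_distr m_comm a_ac)
    then show ?thesis using that double[of "u \<otimes> v"] by (simp add: numeral_2_eq_2)
  qed
  have "z [^] (2 ^ Suc k :: nat) = (z [^] (2 ^ k :: nat)) [^] (2::nat)" if "z \<in> carrier R" for z
    using that by (simp add: nat_pow_pow mult.commute)
  then show ?case using Suc assms sq by simp
qed

lemma (in cring) two_power_finsum_char_2:
  assumes "\<one> \<oplus> \<one> = \<zero>" "finite I" "\<And>i. i \<in> I \<Longrightarrow> f i \<in> carrier R"
  shows "(\<Oplus>i\<in>I. f i) [^] (2 ^ k :: nat) = (\<Oplus>i\<in>I. f i [^] (2 ^ k :: nat))"
  using assms(2,3)
proof (induction I)
  case empty
  then show ?case by (simp add: nat_pow_zero)
next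
  case (insert j I)
  then have "(\<Oplus>i\<in>insert j I. f i) [^] (2 ^ k :: nat) = (f j \<oplus> (\<Oplus>i\<in>I. f i)) [^] (2 ^ k :: nat)"
    by (subst finsum_insert) (auto simp: Pi_def)
  also have "\<dots> = f j [^] (2 ^ k :: nat) \<oplus> (\<Oplus>i\<in>I. f i [^] (2 ^ k :: nat))"
    using insert assms(1) by (subst two_power_add_char_2) (auto intro!: finsum_closed)
  also have "\<dots> = (\<Oplus>i\<in>insert j I. f i [^] (2 ^ k :: nat))"
    using insert by (subst finsum_insert) (auto simp: Pi_def)
  finally show ?case .
qed

lemma (in domain) pow_eq_zero:
  fixes n :: nat
  assumes "x \<in> carrier R" "x [^] n = \<zero>"
  shows "x = \<zero>"
  using assms by (induction n) (auto simp: integral_iff)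

text \<open>By additivity (x + 1)^(2^k) = 1 + 1 = 0, and a domain has no nilpotents; x + 1 = 0 = 1 +
  1 then gives x = 1.\<close>

lemma (in domain) two_power_eq_one_char_2:
  assumes "\<one> \<oplus> \<one> = \<zero>" "x \<in> carrier R" "x [^] (2 ^ k :: nat) = \<one>"
  shows "x = \<one>"
proof -
  have "(x \<oplus> \<one>) [^] (2 ^ k :: nat) = \<zero>" using assms by (simp add: two_power_add_char_2)
  then have "x \<oplus> \<one> = \<zero>" using assms pow_eq_zero by simp
  then show ?thesis using assms by (metis add.r_cancel one_closed)
qed

section \<open>Torsion in unit groups and in finite fields\<close>

lemma (in monoid) pow_eq_one_imp_Units:
  fixes d :: nat
  assumes "x \<in> carrier G" "x [^] d = \<one>" "d > 0"
  shows "x \<in> Units G"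
proof -
  have d: "d = Suc (d - 1)" using assms(3) by simp
  \<comment> \<open>The inverse is x^(d-1).\<close>
  have "x \<otimes> x [^] (d - 1) = \<one>" "x [^] (d - 1) \<otimes> x = \<one>"
    using assms(1,2) d nat_pow_Suc2[of x "d - 1"] nat_pow_Suc[of x "d - 1"] by simp_all
  then show ?thesis using assms(1) unfolding Units_def by blast
qed

text \<open>For positive d every solution is a unit, so all counts may be made in the ring itself,
  without describing its units.\<close>

lemma (in monoid) torsion_units_of:
  assumes "d > 0"
  shows "torsion (units_of G) d = {x \<in> carrier G. x [^] d = \<one>}"
  using assms pow_eq_one_imp_Units Units_closed
  by (auto simp: torsion_def units_of_carrier units_of_one units_of_pow)

lemma (in monoid) pow_gcd_eq_one:
  fixes m n :: nat
  assumes x: "x \<in> carrier G" and "m > 0" "x [^] m = \<one>" "x [^] n = \<one>"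
  shows "x [^] gcd m n = \<one>"
proof -
  have xU: "x \<in> Units G" using assms by (intro pow_eq_one_imp_Units[of x m])
  interpret U: group "units_of G" by (rule units_group)
  have "x \<in> carrier (units_of G)" using xU by (simp add: units_of_carrier)
  from U.pow_eq_id[OF this] have "x [^] k = \<one> \<longleftrightarrow> U.ord x dvd k" for k :: nat
    using xU by (simp add: units_of_pow units_of_one)
  then show ?thesis using assms by simp
qed

lemma (in field) units_of_eq: "units_of R = Multiplicative_Group.mult_of R"
  by (simp add: units_of_def Multiplicative_Group.mult_of_def field_Units)

text \<open>Cyclicity of the multiplicative group, in the form that the counting of torsion in
  cyclic groups asks for.\<close>

lemma (in field) ex_units_generator:
  assumes "finite (carrier R)"
  shows "\<exists>a\<in>carrier (units_of R). group.ord (units_of R) a = order (units_of R)"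
proof -
  obtain a where a: "a \<in> carrier (units_of R)" "carrier (units_of R) = {a [^] i | i :: nat. i \<in> UNIV}"
    unfolding units_of_eq using finite_field_mult_group_has_gen[OF assms] by blast
  interpret M: group "units_of R" by (rule units_group)
  have fin: "finite (carrier (units_of R))" using assms by (simp add: units_of_eq)
  have "a [^]\<^bsub>units_of R\<^esub> i = a [^] i" for i :: nat
    using a(1) by (simp add: units_of_carrier units_of_pow)
  then have "generate (units_of R) {a} = carrier (units_of R)"
    using M.generate_pow_on_finite_carrier[OF fin a(1)] a(2) by simp
  then have "M.ord a = order (units_of R)" using M.generate_pow_card[OF a(1)] by (simp add: order_def)
  then show ?thesis using a(1) by blast
qed

lemma (in field) order_units_of:
  assumes "finite (carrier R)"
  shows "order (units_of R) = card (carrier R) - 1"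
  using assms by (simp add: order_def units_of_eq)

lemma (in field) card_torsion_units_of:
  assumes "finite (carrier R)"
  shows "card (torsion (units_of R) d) = gcd d (card (carrier R) - 1)"
proof -
  interpret M: group "units_of R" by (rule units_group)
  have fin: "finite (carrier (units_of R))" using assms by (simp add: units_of_eq)
  obtain a where "a \<in> carrier (units_of R)" "M.ord a = order (units_of R)"
    using ex_units_generator[OF assms] by blast
  then have "card (torsion (units_of R) d) = gcd d (order (units_of R))"
    by (intro M.card_torsion_cyclic fin)
  then show ?thesis using order_units_of[OF assms] by simp
qed

section \<open>Functions with prescribed sums over the fibres of a map\<close>

lemma (in abelian_group) card_prescribed_fibre_sums:
  assumes fin: "finite I" and c: "\<And>y. y \<in> \<pi> ` I \<Longrightarrow> c y \<in> carrier G"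
  shows "card {f \<in> I \<rightarrow>\<^sub>E carrier G. \<forall>y\<in>\<pi> ` I. (\<Oplus>x\<in>{x \<in> I. \<pi> x = y}. f x) = c y} =
    card (carrier G) ^ (card I - card (\<pi> ` I))"
proof -
  \<comment> \<open>Off one representative of each fibre the values are free, and the sums determine the rest.\<close>
  define s where "s = inv_into I \<pi>"
  define S where "S = s ` \<pi> ` I"
  have s: "s y \<in> I" "\<pi> (s y) = y" if "y \<in> \<pi> ` I" for y
    using that by (auto simp: s_def inv_into_into f_inv_into_f)
  have SX: "S \<subseteq> I" using s by (auto simp: S_def)
  have "inj_on s (\<pi> ` I)" by (metis inj_onI s(2))
  then have cardS: "card S = card (\<pi> ` I)" by (simp add: S_def card_image)
  have inS: "x \<in> S \<longleftrightarrow> x = s (\<pi> x)" if "x \<in> I" for x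
    using that s by (auto simp: S_def)
  define rest where "rest g y = (\<Oplus>x\<in>{x \<in> I - S. \<pi> x = y}. g x)" for g y
  have rest_closed: "rest g y \<in> carrier G" if "g \<in> I - S \<rightarrow> carrier G" for g y
    using that unfolding rest_def by (intro finsum_closed) auto
  have split: "(\<Oplus>x\<in>{x \<in> I. \<pi> x = y}. f x) = f (s y) \<oplus> rest f y"
    if "f \<in> I \<rightarrow> carrier G" "y \<in> \<pi> ` I" for f y
  proof -
    have "{x \<in> I. \<pi> x = y} = insert (s y) {x \<in> I - S. \<pi> x = y}"
      using that(2) s[of y] inS by auto
    moreover have "s y \<notin> {x \<in> I - S. \<pi> x = y}" using that(2) by (auto simp: S_def)
    ultimately show ?thesis
      unfolding rest_def using fin that s(1)[of y] by (auto intro!: finsum_insert)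
  qed
  let ?L = "{f \<in> I \<rightarrow>\<^sub>E carrier G. \<forall>y\<in>\<pi> ` I. (\<Oplus>x\<in>{x \<in> I. \<pi> x = y}. f x) = c y}"
  define ext where "ext g = (\<lambda>x\<in>I. if x \<in> S then c (\<pi> x) \<ominus> rest g (\<pi> x) else g x)" for g
  have rest_eq: "rest f y = rest g y" if "\<And>x. x \<in> I - S \<Longrightarrow> f x = g x" "g \<in> I - S \<rightarrow> carrier G" for f g y
    unfolding rest_def using that by (intro finsum_cong') auto
  have "bij_betw (\<lambda>f. restrict f (I - S)) ?L (I - S \<rightarrow>\<^sub>E carrier G)"
  proof (rule bij_betw_byWitness[where f' = ext])
    show "\<forall>f\<in>?L. ext (restrict f (I - S)) = f"
    proof
      fix f assume f: "f \<in> ?L"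
      then have fc: "f \<in> I \<rightarrow> carrier G" by auto
      show "ext (restrict f (I - S)) = f"
      proof
        fix x
        consider "x \<notin> I" | "x \<in> I - S" | "x \<in> S" using SX by blast
        then show "ext (restrict f (I - S)) x = f x"
        proof cases
          case 3
          then have x: "x \<in> I" "x = s (\<pi> x)" using SX inS by auto
          have "c (\<pi> x) = f x \<oplus> rest f (\<pi> x)" using split[OF fc, of "\<pi> x"] f x by auto
          moreover have "rest (restrict f (I - S)) (\<pi> x) = rest f (\<pi> x)"
            using fc by (intro rest_eq) auto
          moreover have "f x \<in> carrier G" "rest f (\<pi> x) \<in> carrier G" using fc x rest_closed by auto
          ultimately show ?thesis using 3 x(1) by (simp add: ext_def a_minus_def a_assoc r_neg)
        qed (use f in \<open>auto simp: ext_def PiE_iff extensional_def\<close>)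
      qed
    qed
    have ext_closed: "ext g \<in> I \<rightarrow>\<^sub>E carrier G" if g: "g \<in> I - S \<rightarrow>\<^sub>E carrier G" for g
    proof -
      have "g \<in> I - S \<rightarrow> carrier G" using g by auto
      with rest_closed[of g] have "ext g x \<in> carrier G" if "x \<in> I" for x
        using c that by (auto simp: ext_def)
      then show ?thesis by (auto simp: ext_def)
    qed
    show "\<forall>g\<in>I - S \<rightarrow>\<^sub>E carrier G. restrict (ext g) (I - S) = g"
      by (auto simp: ext_def fun_eq_iff PiE_iff extensional_def)
    show "(\<lambda>f. restrict f (I - S)) ` ?L \<subseteq> I - S \<rightarrow>\<^sub>E carrier G" by auto
    show "ext ` (I - S \<rightarrow>\<^sub>E carrier G) \<subseteq> ?L"
    proof (intro image_subsetI CollectI conjI ballI)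
      fix g assume g: "g \<in> I - S \<rightarrow>\<^sub>E carrier G"
      show "ext g \<in> I \<rightarrow>\<^sub>E carrier G" using g by (rule ext_closed)
      fix y assume y: "y \<in> \<pi> ` I"
      have "rest (ext g) y = rest g y" using g by (intro rest_eq) (auto simp: ext_def)
      moreover have "rest g y \<in> carrier G" using g by (intro rest_closed) auto
      moreover have "ext g (s y) = c y \<ominus> rest g y"
        using y s[OF y] by (auto simp: ext_def S_def)
      moreover have "(\<Oplus>x\<in>{x \<in> I. \<pi> x = y}. ext g x) = ext g (s y) \<oplus> rest (ext g) y"
        using ext_closed[OF g] y by (intro split) auto
      ultimately show "(\<Oplus>x\<in>{x \<in> I. \<pi> x = y}. ext g x) = c y"
        using c[OF y] by (simp add: a_minus_def a_assoc l_neg)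
    qed
  qed
  then have "card ?L = card (I - S \<rightarrow>\<^sub>E carrier G)" by (rule bij_betw_same_card)
  also have "\<dots> = card (carrier G) ^ (card I - card (\<pi> ` I))"
    using fin SX by (simp add: card_PiE card_Diff_subset finite_subset cardS)
  finally show ?thesis .
qed

section \<open>Group algebras of abelian groups of exponent dividing 2^e over finite fields of
  characteristic 2\<close>

locale modular_group_algebra = finite_group_algebra R G + field R
  for R (structure) and G +
  fixes e :: nat
  assumes finite_R: "finite (carrier R)"
    and char_2: "\<one> \<oplus> \<one> = \<zero>"
    and exponent: "\<And>x. x \<in> carrier G \<Longrightarrow> x [^]\<^bsub>G\<^esub> (2 ^ e :: nat) = \<one>\<^bsub>G\<^esub>"
begin

text \<open>Frobenius is used twice: in the algebra, to raise the monomials of f separately, and in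
  \<open>R\<close>, to pull the power out of the sum of the coefficients that meet at w.\<close>

lemma two_power_apply:
  assumes f: "f \<in> carrier A" and w: "w \<in> carrier G"
  shows "(f [^]\<^bsub>A\<^esub> (2 ^ k :: nat)) w =
    (\<Oplus>x\<in>{x \<in> carrier G. x [^]\<^bsub>G\<^esub> (2 ^ k :: nat) = w}. f x) [^] (2 ^ k :: nat)"
proof -
  have A2: "\<one>\<^bsub>A\<^esub> \<oplus>\<^bsub>A\<^esub> \<one>\<^bsub>A\<^esub> = \<zero>\<^bsub>A\<^esub>" using char_2 by (auto simp: one_A add_A zero_A fun_eq_iff)
  have "f [^]\<^bsub>A\<^esub> (2 ^ k :: nat) = (\<Oplus>\<^bsub>A\<^esub>x\<in>carrier G. single x (f x)) [^]\<^bsub>A\<^esub> (2 ^ k :: nat)"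
    using eq_finsum_single[OF f] by simp
  also have "\<dots> = (\<Oplus>\<^bsub>A\<^esub>x\<in>carrier G. single x (f x) [^]\<^bsub>A\<^esub> (2 ^ k :: nat))"
    using f finite_G A2 by (intro A.two_power_finsum_char_2) (auto simp: single_closed A_apply)
  also have "\<dots> = (\<Oplus>\<^bsub>A\<^esub>x\<in>carrier G. single (x [^]\<^bsub>G\<^esub> (2 ^ k :: nat)) (f x [^] (2 ^ k :: nat)))"
    using f by (intro A.finsum_cong') (auto simp: single_closed A_apply single_pow)
  finally have "(f [^]\<^bsub>A\<^esub> (2 ^ k :: nat)) w =
      (\<Oplus>x\<in>carrier G. single (x [^]\<^bsub>G\<^esub> (2 ^ k :: nat)) (f x [^] (2 ^ k :: nat)) w)"
    using f w finite_G by (simp add: finsum_A_apply single_closed A_apply)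
  also have "\<dots> = (\<Oplus>x\<in>{x \<in> carrier G. x [^]\<^bsub>G\<^esub> (2 ^ k :: nat) = w}. f x [^] (2 ^ k :: nat))"
    using f w finite_G
    by (intro R.add.finprod_mono_neutral_cong_right) (auto simp: single_def A_apply)
  also have "\<dots> = (\<Oplus>x\<in>{x \<in> carrier G. x [^]\<^bsub>G\<^esub> (2 ^ k :: nat) = w}. f x) [^] (2 ^ k :: nat)"
    using f finite_G by (intro R.two_power_finsum_char_2[symmetric] char_2) (auto simp: A_apply)
  finally show ?thesis .
qed

lemma card_two_power_torsion:
  "card {f \<in> carrier A. f [^]\<^bsub>A\<^esub> (2 ^ k :: nat) = \<one>\<^bsub>A\<^esub>} =
    card (carrier R) ^ (card (carrier G) - card ((\<lambda>x. x [^]\<^bsub>G\<^esub> (2 ^ k :: nat)) ` carrier G))"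
proof -
  let ?\<pi> = "\<lambda>x. x [^]\<^bsub>G\<^esub> (2 ^ k :: nat)"
  have im: "?\<pi> ` carrier G \<subseteq> carrier G" by auto
  have "f [^]\<^bsub>A\<^esub> (2 ^ k :: nat) = \<one>\<^bsub>A\<^esub> \<longleftrightarrow>
      (\<forall>y\<in>?\<pi> ` carrier G. (\<Oplus>x\<in>{x \<in> carrier G. ?\<pi> x = y}. f x) = (if y = \<one>\<^bsub>G\<^esub> then \<one> else \<zero>))"
    (is "_ \<longleftrightarrow> (\<forall>y\<in>_. ?s y = _)") if f: "f \<in> carrier A" for f
  proof -
    have sc: "?s y \<in> carrier R" for y using f by (intro R.finsum_closed) (auto simp: A_apply)
    have pow0: "?s y [^] (2 ^ k :: nat) = \<zero> \<longleftrightarrow> ?s y = \<zero>" for y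
      using pow_eq_zero[OF sc[of y], of "2 ^ k"] by (auto simp: R.nat_pow_zero)
    \<comment> \<open>In the field \<open>R\<close> only 0 and 1 have 2^k-th power 0 and 1,
      respectively, so the condition on the power becomes linear in f.\<close>
    have pow: "?s y [^] (2 ^ k :: nat) = (if y = \<one>\<^bsub>G\<^esub> then \<one> else \<zero>) \<longleftrightarrow>
        ?s y = (if y = \<one>\<^bsub>G\<^esub> then \<one> else \<zero>)" for y
      using two_power_eq_one_char_2[OF char_2 sc[of y], of k] sc[of y]
      by (auto simp: R.nat_pow_zero pow0)
    \<comment> \<open>Over y that is not a 2^k-th power the fibre is empty and its sum is 0, the
      prescribed value since y differs from 1. So the conditions over the image are all there
      is.\<close>
    have out: "?s y = \<zero>" if "y \<notin> ?\<pi> ` carrier G" for y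
    proof -
      have "{x \<in> carrier G. ?\<pi> x = y} = {}" using that by auto
      then show ?thesis by (simp only: R.finsum_empty)
    qed
    have "\<one>\<^bsub>G\<^esub> \<in> ?\<pi> ` carrier G" using G.nat_pow_one G.one_closed by (metis image_eqI)
    have "f [^]\<^bsub>A\<^esub> (2 ^ k :: nat) = \<one>\<^bsub>A\<^esub> \<longleftrightarrow>
        (\<forall>y\<in>carrier G. (f [^]\<^bsub>A\<^esub> (2 ^ k :: nat)) y = \<one>\<^bsub>A\<^esub> y)"
      using f by (auto intro!: A_eqI)
    then have "f [^]\<^bsub>A\<^esub> (2 ^ k :: nat) = \<one>\<^bsub>A\<^esub> \<longleftrightarrow>
        (\<forall>y\<in>carrier G. ?s y = (if y = \<one>\<^bsub>G\<^esub> then \<one> else \<zero>))"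
      by (simp add: two_power_apply[OF f] one_A pow)
    moreover have "?s y = (if y = \<one>\<^bsub>G\<^esub> then \<one> else \<zero>)" if "y \<notin> ?\<pi> ` carrier G" for y
      using out[OF that] that \<open>\<one>\<^bsub>G\<^esub> \<in> ?\<pi> ` carrier G\<close> by metis
    ultimately show ?thesis using im by blast
  qed
  then have "{f \<in> carrier A. f [^]\<^bsub>A\<^esub> (2 ^ k :: nat) = \<one>\<^bsub>A\<^esub>} =
    {f \<in> carrier G \<rightarrow>\<^sub>E carrier R. \<forall>y\<in>?\<pi> ` carrier G.
      (\<Oplus>x\<in>{x \<in> carrier G. ?\<pi> x = y}. f x) = (if y = \<one>\<^bsub>G\<^esub> then \<one> else \<zero>)}"
    unfolding carrier_A[symmetric] by (intro Collect_cong) blast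
  then show ?thesis
    using R.card_prescribed_fibre_sums[OF finite_G, of ?\<pi> "\<lambda>y. if y = \<one>\<^bsub>G\<^esub> then \<one> else \<zero>"] by simp
qed

definition aug :: "('c \<Rightarrow> 'a) \<Rightarrow> 'a" where
  "aug f = (\<Oplus>x\<in>carrier G. f x)"

text \<open>The augmentation is evaluation at the trivial character.\<close>

lemma aug_hom: "ring_hom_cring A R aug"
proof -
  have "(\<lambda>f. \<Oplus>x\<in>carrier G. f x \<otimes> \<one>) \<in> ring_hom A R"
    by (intro ring_hom_evaluation[OF ring_hom_cring_id, of "\<lambda>_. \<one>"]) auto
  moreover have "(\<Oplus>x\<in>carrier G. f x \<otimes> \<one>) = aug f" if "f \<in> carrier A" for f
    unfolding aug_def using that by (intro R.finsum_cong') (auto simp: A_apply)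
  ultimately have "aug \<in> ring_hom A R"
    by (auto simp: ring_hom_def A.m_closed A.a_closed Pi_def)
  then show ?thesis by (intro ring_hom_cringI cring_A R.is_cring)
qed

sublocale aug: ring_hom_cring A R aug by (rule aug_hom)

text \<open>All of G is the fibre over 1 of the 2^e-th power map, so the power is a constant. In
  particular augmentation 1 implies order dividing 2^e.\<close>

lemma exponent_pow:
  assumes f: "f \<in> carrier A"
  shows "f [^]\<^bsub>A\<^esub> (2 ^ e :: nat) = single \<one>\<^bsub>G\<^esub> (aug f [^] (2 ^ e :: nat))"
proof (rule A_eqI)
  fix w assume w: "w \<in> carrier G"
  have "{x \<in> carrier G. x [^]\<^bsub>G\<^esub> (2 ^ e :: nat) = w} = (if w = \<one>\<^bsub>G\<^esub> then carrier G else {})"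
    using exponent by auto
  then show "(f [^]\<^bsub>A\<^esub> (2 ^ e :: nat)) w = single \<one>\<^bsub>G\<^esub> (aug f [^] (2 ^ e :: nat)) w"
    using f w by (auto simp: two_power_apply single_def aug_def R.nat_pow_zero)
qed (use f in \<open>auto simp: single_closed\<close>)

lemma aug_single_one: "a \<in> carrier R \<Longrightarrow> aug (single \<one>\<^bsub>G\<^esub> a) = a"
proof -
  assume a: "a \<in> carrier R"
  have "aug (single \<one>\<^bsub>G\<^esub> a) = (\<Oplus>x\<in>carrier G. if x = \<one>\<^bsub>G\<^esub> then a else \<zero>)"
    unfolding aug_def using a by (intro R.finsum_cong') (auto simp: single_def)
  then show ?thesis using a finite_G by (simp add: R.finsum_delta)
qed

text \<open>A unit \<open>u\<close> is the product of \<open>u / aug u\<close>, whose order divides \<open>2\<^sup>e\<close>, and the constant \<open>aug u\<close>.\<close>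

lemma card_torsion_units:
  assumes d: "d > 0"
  shows "card (torsion (units_of A) d) =
    card (torsion (units_of A) (gcd d (2 ^ e))) * card (torsion (units_of R) d)"
proof -
  let ?g = "gcd d (2 ^ e)"
  let ?E = "2 ^ e :: nat"
  have g: "?g > 0" using d by simp
  note tors = A.torsion_units_of[OF d] A.torsion_units_of[OF g]
  have torsR: "torsion (units_of R) d = {a \<in> carrier R. a [^] d = \<one>}"
    using d by (rule R.torsion_units_of)
  \<comment> \<open>The augmentation of \<open>v\<close> is a root of unity of 2-power order in a
    field of characteristic 2, hence 1. This makes the constant factor of a product
    recoverable.\<close>
  have aug1: "aug v = \<one>" if v: "v \<in> carrier A" "v [^]\<^bsub>A\<^esub> ?g = \<one>\<^bsub>A\<^esub>" for v
  proof -
    obtain m where "?E = ?g * m" by (metis dvdE gcd_dvd2)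
    then have "v [^]\<^bsub>A\<^esub> ?E = \<one>\<^bsub>A\<^esub>" using v by (metis A.nat_pow_one A.nat_pow_pow)
    then have "aug v [^] ?E = \<one>" using v aug.hom_pow[of v ?E] by simp
    then show ?thesis using v two_power_eq_one_char_2[OF char_2] by simp
  qed
  have nz: "a \<in> Units R" if "a \<in> carrier R" "a [^] d = \<one>" for a
    using that d by (intro R.pow_eq_one_imp_Units[of a d]) auto
  have invc: "inv a \<in> carrier R" "a \<otimes> inv a = \<one>" "inv a \<otimes> a = \<one>" "inv a [^] n \<otimes> a [^] n = \<one>"
    if "a \<in> carrier R" "a [^] d = \<one>" for a and n :: nat
    using nz[OF that] that by (simp_all flip: R.nat_pow_distrib)
  have "bij_betw (\<lambda>(v, a). v \<otimes>\<^bsub>A\<^esub> single \<one>\<^bsub>G\<^esub> a)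
    (torsion (units_of A) ?g \<times> torsion (units_of R) d) (torsion (units_of A) d)"
    unfolding tors torsR
  proof (rule bij_betw_byWitness[where f' = "\<lambda>u. (u \<otimes>\<^bsub>A\<^esub> single \<one>\<^bsub>G\<^esub> (inv (aug u)), aug u)"])
    show "\<forall>x\<in>{v \<in> carrier A. v [^]\<^bsub>A\<^esub> ?g = \<one>\<^bsub>A\<^esub>} \<times> {a \<in> carrier R. a [^] d = \<one>}.
      (\<lambda>u. (u \<otimes>\<^bsub>A\<^esub> single \<one>\<^bsub>G\<^esub> (inv (aug u)), aug u)) ((\<lambda>(v, a). v \<otimes>\<^bsub>A\<^esub> single \<one>\<^bsub>G\<^esub> a) x) = x"
    proof
      fix x assume "x \<in> {v \<in> carrier A. v [^]\<^bsub>A\<^esub> ?g = \<one>\<^bsub>A\<^esub>} \<times> {a \<in> carrier R. a [^] d = \<one>}"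
      then obtain v a where x: "x = (v, a)" and v: "v \<in> carrier A" "v [^]\<^bsub>A\<^esub> ?g = \<one>\<^bsub>A\<^esub>"
        and a: "a \<in> carrier R" "a [^] d = \<one>" by auto
      have au: "aug (v \<otimes>\<^bsub>A\<^esub> single \<one>\<^bsub>G\<^esub> a) = a"
        using v a aug1[OF v] by (simp add: single_closed aug_single_one)
      have "v \<otimes>\<^bsub>A\<^esub> single \<one>\<^bsub>G\<^esub> a \<otimes>\<^bsub>A\<^esub> single \<one>\<^bsub>G\<^esub> (inv a) = v \<otimes>\<^bsub>A\<^esub> single \<one>\<^bsub>G\<^esub> \<one>"
        using v a invc[OF a] by (simp add: A.m_assoc single_closed single_mult_single)
      then have "v \<otimes>\<^bsub>A\<^esub> single \<one>\<^bsub>G\<^esub> a \<otimes>\<^bsub>A\<^esub> single \<one>\<^bsub>G\<^esub> (inv a) = v"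
        using v by (simp flip: one_A_eq_single)
      then show "(\<lambda>u. (u \<otimes>\<^bsub>A\<^esub> single \<one>\<^bsub>G\<^esub> (inv (aug u)), aug u)) ((\<lambda>(v, a). v \<otimes>\<^bsub>A\<^esub> single \<one>\<^bsub>G\<^esub> a) x) = x"
        using au by (simp add: x)
    qed
    have augd: "aug u \<in> carrier R" "aug u [^] d = \<one>" if "u \<in> carrier A" "u [^]\<^bsub>A\<^esub> d = \<one>\<^bsub>A\<^esub>" for u
      using that aug.hom_pow[of u d] by simp_all
    show "\<forall>u\<in>{u \<in> carrier A. u [^]\<^bsub>A\<^esub> d = \<one>\<^bsub>A\<^esub>}.
      (\<lambda>(v, a). v \<otimes>\<^bsub>A\<^esub> single \<one>\<^bsub>G\<^esub> a) (u \<otimes>\<^bsub>A\<^esub> single \<one>\<^bsub>G\<^esub> (inv (aug u)), aug u) = u"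
    proof clarify
      fix u assume u: "u \<in> carrier A" "u [^]\<^bsub>A\<^esub> d = \<one>\<^bsub>A\<^esub>"
      note a = augd[OF u]
      have "u \<otimes>\<^bsub>A\<^esub> single \<one>\<^bsub>G\<^esub> (inv (aug u)) \<otimes>\<^bsub>A\<^esub> single \<one>\<^bsub>G\<^esub> (aug u) = u \<otimes>\<^bsub>A\<^esub> single \<one>\<^bsub>G\<^esub> \<one>"
        using u a invc[OF a] by (simp add: A.m_assoc single_closed single_mult_single)
      then show "u \<otimes>\<^bsub>A\<^esub> single \<one>\<^bsub>G\<^esub> (inv (aug u)) \<otimes>\<^bsub>A\<^esub> single \<one>\<^bsub>G\<^esub> (aug u) = u"
        using u by (simp flip: one_A_eq_single)
    qed
    show "(\<lambda>(v, a). v \<otimes>\<^bsub>A\<^esub> single \<one>\<^bsub>G\<^esub> a) `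
      ({v \<in> carrier A. v [^]\<^bsub>A\<^esub> ?g = \<one>\<^bsub>A\<^esub>} \<times> {a \<in> carrier R. a [^] d = \<one>}) \<subseteq> {u \<in> carrier A. u [^]\<^bsub>A\<^esub> d = \<one>\<^bsub>A\<^esub>}"
    proof clarify
      fix v a assume v: "v \<in> carrier A" "v [^]\<^bsub>A\<^esub> ?g = \<one>\<^bsub>A\<^esub>" and a: "a \<in> carrier R" "a [^] d = \<one>"
      obtain m where "d = ?g * m" by (metis dvdE gcd_dvd1)
      then have "v [^]\<^bsub>A\<^esub> d = \<one>\<^bsub>A\<^esub>" using v by (metis A.nat_pow_one A.nat_pow_pow)
      then show "v \<otimes>\<^bsub>A\<^esub> single \<one>\<^bsub>G\<^esub> a \<in> carrier A \<and> (v \<otimes>\<^bsub>A\<^esub> single \<one>\<^bsub>G\<^esub> a) [^]\<^bsub>A\<^esub> d = \<one>\<^bsub>A\<^esub>"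
        using v a by (simp add: A.nat_pow_distrib single_closed single_pow one_A_eq_single[symmetric])
    qed
    show "(\<lambda>u. (u \<otimes>\<^bsub>A\<^esub> single \<one>\<^bsub>G\<^esub> (inv (aug u)), aug u)) ` {u \<in> carrier A. u [^]\<^bsub>A\<^esub> d = \<one>\<^bsub>A\<^esub>} \<subseteq>
      {v \<in> carrier A. v [^]\<^bsub>A\<^esub> ?g = \<one>\<^bsub>A\<^esub>} \<times> {a \<in> carrier R. a [^] d = \<one>}"
    proof (intro image_subsetI)
      fix u assume "u \<in> {u \<in> carrier A. u [^]\<^bsub>A\<^esub> d = \<one>\<^bsub>A\<^esub>}"
      then have u: "u \<in> carrier A" "u [^]\<^bsub>A\<^esub> d = \<one>\<^bsub>A\<^esub>" by auto
      note a = augd[OF u]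
      let ?v = "u \<otimes>\<^bsub>A\<^esub> single \<one>\<^bsub>G\<^esub> (inv (aug u))"
      have vc: "?v \<in> carrier A" using u invc(1)[OF a] by (simp add: single_closed)
      have "inv (aug u) [^] d = \<one>" using invc(1)[OF a] invc(4)[OF a, of d] a(2) by simp
      then have "?v [^]\<^bsub>A\<^esub> d = \<one>\<^bsub>A\<^esub>"
        using u invc(1)[OF a] by (simp add: A.nat_pow_distrib single_closed single_pow one_A_eq_single[symmetric])
      \<comment> \<open>\<open>?v\<close> has augmentation 1, so its 2^e-th power is the constant 1;
        being annihilated by d as well, it is annihilated by the gcd.\<close>
      moreover have "?v [^]\<^bsub>A\<^esub> ?E = \<one>\<^bsub>A\<^esub>"
        using u a invc(1,2)[OF a] vc
        by (simp add: exponent_pow single_closed aug_single_one one_A_eq_single)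
      ultimately have "?v [^]\<^bsub>A\<^esub> ?g = \<one>\<^bsub>A\<^esub>" using vc d by (intro A.pow_gcd_eq_one)
      then show "(?v, aug u) \<in> {v \<in> carrier A. v [^]\<^bsub>A\<^esub> ?g = \<one>\<^bsub>A\<^esub>} \<times> {a \<in> carrier R. a [^] d = \<one>}"
        using vc a by simp
    qed
  qed
  then show ?thesis by (metis bij_betw_same_card card_cartesian_product)
qed

theorem card_torsion_units_eq:
  assumes d: "d > 0"
  shows "card (torsion (units_of A) d) =
    card (carrier R) ^ (card (carrier G) - card ((\<lambda>x. x [^]\<^bsub>G\<^esub> gcd d (2 ^ e)) ` carrier G))
      * gcd d (card (carrier R) - 1)"
proof -
  \<comment> \<open>A divisor of 2^e is a power of two, so the 2-part of the torsion falls under the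
    Frobenius count.\<close>
  obtain k where "gcd d (2 ^ e) = 2 ^ k"
    using divides_primepow_nat[of 2 "gcd d (2 ^ e)" e] by auto
  moreover have "gcd d (2 ^ e) > 0" using d by simp
  ultimately show ?thesis
    using card_torsion_units[OF d] card_two_power_torsion[of k] card_torsion_units_of[OF finite_R]
    by (simp add: A.torsion_units_of)
qed

end

section \<open>Odd characteristic\<close>

text \<open>The pair \<open>(a, b)\<close> stands for \<open>a + b \<surd>r\<close>.\<close>

definition quadratic_extension :: "('a, 'm) ring_scheme \<Rightarrow> 'a \<Rightarrow> ('a \<times> 'a) ring" where
  "quadratic_extension R r =
    \<lparr>carrier = carrier R \<times> carrier R,
     monoid.mult = (\<lambda>(a, b) (c, d).
       (a \<otimes>\<^bsub>R\<^esub> c \<oplus>\<^bsub>R\<^esub> r \<otimes>\<^bsub>R\<^esub> (b \<otimes>\<^bsub>R\<^esub> d), a \<otimes>\<^bsub>R\<^esub> d \<oplus>\<^bsub>R\<^esub> b \<otimes>\<^bsub>R\<^esub> c)),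
     one = (\<one>\<^bsub>R\<^esub>, \<zero>\<^bsub>R\<^esub>),
     ring.zero = (\<zero>\<^bsub>R\<^esub>, \<zero>\<^bsub>R\<^esub>),
     ring.add = (\<lambda>(a, b) (c, d). (a \<oplus>\<^bsub>R\<^esub> c, b \<oplus>\<^bsub>R\<^esub> d))\<rparr>"

lemma quadratic_extension_simps:
  "carrier (quadratic_extension R r) = carrier R \<times> carrier R"
  "(a, b) \<otimes>\<^bsub>quadratic_extension R r\<^esub> (c, d) =
    (a \<otimes>\<^bsub>R\<^esub> c \<oplus>\<^bsub>R\<^esub> r \<otimes>\<^bsub>R\<^esub> (b \<otimes>\<^bsub>R\<^esub> d), a \<otimes>\<^bsub>R\<^esub> d \<oplus>\<^bsub>R\<^esub> b \<otimes>\<^bsub>R\<^esub> c)"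
  "\<one>\<^bsub>quadratic_extension R r\<^esub> = (\<one>\<^bsub>R\<^esub>, \<zero>\<^bsub>R\<^esub>)"
  "\<zero>\<^bsub>quadratic_extension R r\<^esub> = (\<zero>\<^bsub>R\<^esub>, \<zero>\<^bsub>R\<^esub>)"
  "(a, b) \<oplus>\<^bsub>quadratic_extension R r\<^esub> (c, d) = (a \<oplus>\<^bsub>R\<^esub> c, b \<oplus>\<^bsub>R\<^esub> d)"
  by (simp_all add: quadratic_extension_def)

lemma (in cring) quadratic_extension_cring:
  assumes r: "r \<in> carrier R"
  shows "cring (quadratic_extension R r)"
proof (rule cringI)
  let ?K = "quadratic_extension R r"
  note simps = quadratic_extension_simps
  show "abelian_group ?K"
  proof (rule abelian_groupI)
    fix x assume "x \<in> carrier ?K"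
    then show "\<exists>y\<in>carrier ?K. y \<oplus>\<^bsub>?K\<^esub> x = \<zero>\<^bsub>?K\<^esub>"
      by (intro bexI[of _ "(\<ominus> fst x, \<ominus> snd x)"]) (auto simp: simps l_neg)
  qed (auto simp: simps a_ac)
  show "comm_monoid ?K"
  proof (rule comm_monoidI)
    fix x y z assume "x \<in> carrier ?K" "y \<in> carrier ?K" "z \<in> carrier ?K"
    then show "x \<otimes>\<^bsub>?K\<^esub> y \<otimes>\<^bsub>?K\<^esub> z = x \<otimes>\<^bsub>?K\<^esub> (y \<otimes>\<^bsub>?K\<^esub> z)"
      using r by (auto simp: simps l_distr r_distr m_ac a_ac)
  next
    fix x y assume "x \<in> carrier ?K" "y \<in> carrier ?K"
    then show "x \<otimes>\<^bsub>?K\<^esub> y = y \<otimes>\<^bsub>?K\<^esub> x"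
      using r by (auto simp: simps m_ac a_ac)
  qed (use r in \<open>auto simp: simps\<close>)
  fix x y z assume "x \<in> carrier ?K" "y \<in> carrier ?K" "z \<in> carrier ?K"
  then show "(x \<oplus>\<^bsub>?K\<^esub> y) \<otimes>\<^bsub>?K\<^esub> z = x \<otimes>\<^bsub>?K\<^esub> z \<oplus>\<^bsub>?K\<^esub> y \<otimes>\<^bsub>?K\<^esub> z"
    using r by (auto simp: simps l_distr r_distr m_ac a_ac)
qed

text \<open>The inverse of a + b sqrt r is its conjugate divided by the norm N = a^2 - r b^2. If N
  were 0, then b = 0 would give a = 0, and otherwise r would be the square of a/b.\<close>

lemma (in field) quadratic_extension_field:
  assumes r: "r \<in> carrier R" and nonsquare: "\<And>x. x \<in> carrier R \<Longrightarrow> x \<otimes> x \<noteq> r"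
  shows "field (quadratic_extension R r)"
proof -
  let ?K = "quadratic_extension R r"
  note simps = quadratic_extension_simps
  interpret K: cring ?K using r by (rule quadratic_extension_cring)
  show ?thesis
  proof (rule K.cring_fieldI2)
    fix x assume x: "x \<in> carrier ?K" "x \<noteq> \<zero>\<^bsub>?K\<^esub>"
    obtain a b where ab: "x = (a, b)" "a \<in> carrier R" "b \<in> carrier R" "a \<noteq> \<zero> \<or> b \<noteq> \<zero>"
      using x by (cases x) (auto simp: simps)
    define N where "N = a \<otimes> a \<ominus> r \<otimes> (b \<otimes> b)"
    have Nc: "N \<in> carrier R" using ab r by (simp add: N_def)
    have "N \<noteq> \<zero>"
    proof
      assume "N = \<zero>"
      then have eq: "a \<otimes> a = r \<otimes> (b \<otimes> b)" using ab r by (simp add: N_def)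
      show False
      proof (cases "b = \<zero>")
        case True
        then show False using eq ab r by (simp add: integral_iff)
      next
        case False
        then have b: "b \<in> Units R" using ab by (simp add: field_Units)
        have "(a \<otimes> inv b) \<otimes> (a \<otimes> inv b) = (a \<otimes> a) \<otimes> (inv b \<otimes> inv b)"
          using ab b by (simp add: m_ac)
        also have "\<dots> = r \<otimes> ((b \<otimes> inv b) \<otimes> (b \<otimes> inv b))"
          unfolding eq using ab b r by (simp add: m_ac del: Units_r_inv)
        also have "\<dots> = r" using b r by simp
        finally show False using nonsquare[of "a \<otimes> inv b"] ab b by simp
      qed
    qed
    then have N: "N \<in> Units R" using Nc by (simp add: field_Units)
    define M where "M = inv N"
    have M: "M \<in> carrier R" "N \<otimes> M = \<one>" using N by (simp_all add: M_def)
    have "x \<otimes>\<^bsub>?K\<^esub> (a \<otimes> M, \<ominus> b \<otimes> M) = (N \<otimes> M, \<zero>)"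
    proof -
      have "a \<otimes> (a \<otimes> M) \<oplus> r \<otimes> (b \<otimes> (\<ominus> b \<otimes> M)) = N \<otimes> M"
        unfolding N_def using ab r M
        by (simp add: a_minus_def l_distr r_distr m_ac l_minus r_minus)
      moreover have "a \<otimes> (\<ominus> b \<otimes> M) \<oplus> b \<otimes> (a \<otimes> M) = \<zero>"
        using ab M by (simp add: m_ac l_minus r_minus l_neg)
      ultimately show ?thesis by (simp add: simps ab)
    qed
    then show "\<exists>y\<in>carrier ?K. x \<otimes>\<^bsub>?K\<^esub> y = \<one>\<^bsub>?K\<^esub>"
      using ab M by (intro bexI[of _ "(a \<otimes> M, \<ominus> b \<otimes> M)"]) (auto simp: simps)
  qed (simp add: simps)
qed

lemma (in cring) quadratic_extension_embedding:
  assumes "r \<in> carrier R"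
  shows "ring_hom_cring R (quadratic_extension R r) (\<lambda>a. (a, \<zero>))"
  using assms
  by (intro ring_hom_cringI ring_hom_memI quadratic_extension_cring is_cring)
    (auto simp: quadratic_extension_simps)

lemma (in cring) quadratic_extension_conjugation:
  assumes "r \<in> carrier R"
  shows "ring_hom_cring (quadratic_extension R r) (quadratic_extension R r) (\<lambda>(a, b). (a, \<ominus> b))"
  using assms
  by (intro ring_hom_cringI ring_hom_memI quadratic_extension_cring)
    (auto simp: quadratic_extension_simps l_minus r_minus minus_add a_ac)

text \<open>Squaring identifies 1 and -1, which are distinct, so it is not injective and, on a
  finite set, not surjective.\<close>

lemma (in field) exists_nonsquare:
  assumes "finite (carrier R)" "\<one> \<oplus> \<one> \<noteq> \<zero>"
  shows "\<exists>r\<in>carrier R. \<forall>x\<in>carrier R. x \<otimes> x \<noteq> r"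
proof (rule ccontr)
  assume "\<not> ?thesis"
  then have "carrier R \<subseteq> (\<lambda>x. x \<otimes> x) ` carrier R" by (auto simp: image_iff)
  then have "inj_on (\<lambda>x. x \<otimes> x) (carrier R)"
    using assms(1) by (intro eq_card_imp_inj_on) (auto intro!: card_subset_eq[symmetric] arg_cong[of _ _ card])
  moreover have "\<ominus> \<one> \<otimes> \<ominus> \<one> = \<one> \<otimes> \<one>" by (simp add: l_minus r_minus)
  ultimately have "\<ominus> \<one> = \<one>" by (rule inj_onD) auto
  then show False using assms(2) by (metis one_closed r_neg)
qed

text \<open>Shows that the lengths 8 and 4 of the Fourier sums are nonzero scalars once 1 + 1 is
  nonzero in a domain.\<close>

lemma (in cring) add_pow_two_power_one:
  "[(2 ^ k :: nat)] \<cdot> \<one> = (\<one> \<oplus> \<one>) [^] k"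
proof (induction k)
  case 0
  then show ?case by simp
next
  case (Suc k)
  have "[(2 ^ Suc k :: nat)] \<cdot> \<one> = [(2 ^ k :: nat)] \<cdot> \<one> \<oplus> [(2 ^ k :: nat)] \<cdot> \<one>"
    by (simp add: mult_2 add.nat_pow_mult)
  also have "\<dots> = (\<one> \<oplus> \<one>) [^] k \<otimes> (\<one> \<oplus> \<one>)" unfolding Suc by (simp add: r_distr)
  finally show ?case by simp
qed

section \<open>Geometric sums, Fourier inversion and equivariant vectors\<close>

lemma (in domain) geometric_sum_root_of_unity:
  fixes m :: nat
  assumes x: "x \<in> carrier R" "x [^] m = \<one>" "x \<noteq> \<one>"
  shows "(\<Oplus>i\<in>{..<m}. x [^] i) = \<zero>"
proof -
  have closed: "(\<Oplus>i\<in>{..<k}. x [^] i) \<in> carrier R" for k :: nat using x by (intro finsum_closed) auto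
  \<comment> \<open>For the partial sums S this is S x + 1 = S + x^k. At k = m it becomes S x = S,
    so S = 0 as x is not 1.\<close>
  have "(\<Oplus>i\<in>{..<k}. x [^] i) \<otimes> x \<oplus> \<one> = (\<Oplus>i\<in>{..<k}. x [^] i) \<oplus> x [^] k" for k :: nat
  proof (induction k)
    case 0
    then show ?case using x by simp
  next
    case (Suc k)
    have step: "(\<Oplus>i\<in>{..<Suc k}. x [^] i) = x [^] k \<oplus> (\<Oplus>i\<in>{..<k}. x [^] i)"
      unfolding lessThan_Suc using x by (subst finsum_insert) auto
    have "(\<Oplus>i\<in>{..<Suc k}. x [^] i) \<otimes> x \<oplus> \<one> =
        x [^] Suc k \<oplus> ((\<Oplus>i\<in>{..<k}. x [^] i) \<otimes> x \<oplus> \<one>)"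
      unfolding step using x closed[of k] by (simp add: l_distr a_assoc)
    then show ?case unfolding Suc step using x closed[of k] by (simp add: a_ac)
  qed
  from this[of m] have "(\<Oplus>i\<in>{..<m}. x [^] i) \<otimes> x = (\<Oplus>i\<in>{..<m}. x [^] i) \<otimes> \<one>"
    using x closed[of m] by simp
  then show ?thesis using x closed[of m] by (metis m_lcancel one_closed)
qed

text \<open>Fourier inversion: weighting the j-th transform with w^(-k j) and summing over j leaves
  m c_k by orthogonality of the powers of w, and m is nonzero in the ring.\<close>

lemma (in domain) fourier_injective:
  fixes m :: nat
  assumes w: "w \<in> carrier R" "\<And>n :: nat. w [^] n = \<one> \<longleftrightarrow> m dvd n" and m: "[m] \<cdot> \<one> \<noteq> \<zero>"
    and c: "\<And>i. i < m \<Longrightarrow> c i \<in> carrier R"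
    and zero: "\<And>j. j < m \<Longrightarrow> (\<Oplus>i\<in>{..<m}. c i \<otimes> w [^] (i * j)) = \<zero>"
    and k: "k < m"
  shows "c k = \<zero>"
proof -
  \<comment> \<open>The exponent m - k takes the place of -k, which keeps all exponents natural
    numbers.\<close>
  have "\<zero> = (\<Oplus>j\<in>{..<m}. (\<Oplus>i\<in>{..<m}. c i \<otimes> w [^] (i * j)) \<otimes> w [^] ((m - k) * j))"
    using w zero by (intro add.finprod_one_eqI[symmetric]) simp
  also have "\<dots> = (\<Oplus>j\<in>{..<m}. \<Oplus>i\<in>{..<m}. c i \<otimes> (w [^] (i + (m - k))) [^] j)"
  proof (rule finsum_cong')
    fix j
    have "(\<Oplus>i\<in>{..<m}. c i \<otimes> w [^] (i * j)) \<otimes> w [^] ((m - k) * j) =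
        (\<Oplus>i\<in>{..<m}. c i \<otimes> w [^] (i * j) \<otimes> w [^] ((m - k) * j))"
      using w c by (intro finsum_ldistr) auto
    also have "\<dots> = (\<Oplus>i\<in>{..<m}. c i \<otimes> (w [^] (i + (m - k))) [^] j)"
      using w c by (intro finsum_cong') (auto simp: m_assoc nat_pow_mult nat_pow_pow add_mult_distrib)
    finally show "(\<Oplus>i\<in>{..<m}. c i \<otimes> w [^] (i * j)) \<otimes> w [^] ((m - k) * j) =
        (\<Oplus>i\<in>{..<m}. c i \<otimes> (w [^] (i + (m - k))) [^] j)" .
  qed (use w c in \<open>auto intro!: finsum_closed\<close>)
  also have "\<dots> = (\<Oplus>i\<in>{..<m}. \<Oplus>j\<in>{..<m}. c i \<otimes> (w [^] (i + (m - k))) [^] j)"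
    using w c by (intro finsum_swap) auto
  also have "\<dots> = (\<Oplus>i\<in>{..<m}. if i = k then c k \<otimes> [m] \<cdot> \<one> else \<zero>)"
  proof (rule finsum_cong')
    fix i assume i: "i \<in> {..<m}"
    let ?x = "w [^] (i + (m - k))"
    have "(\<Oplus>j\<in>{..<m}. c i \<otimes> ?x [^] j) = c i \<otimes> (\<Oplus>j\<in>{..<m}. ?x [^] j)"
      using w c i by (intro finsum_rdistr[symmetric]) auto
    also have "\<dots> = (if i = k then c k \<otimes> [m] \<cdot> \<one> else \<zero>)"
    proof (cases "i = k")
      case True
      then have "?x = \<one>" using w k by simp
      then show ?thesis using True by (simp add: add.finprod_const)
    next
      case False
      \<comment> \<open>The number lies strictly between 0 and 2 m, so it could only be m itself,
        that is i = k.\<close>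
      have "\<not> m dvd i + (m - k)"
      proof
        assume "m dvd i + (m - k)"
        then obtain l where l: "i + (m - k) = m * l" by auto
        have "0 < i + (m - k)" "i + (m - k) < m * 2" using i k by auto
        then have "0 < l" "l < 2" unfolding l by auto
        then have "l = 1" by auto
        then show False using l i k False by auto
      qed
      moreover have "?x [^] m = \<one>" using w by (simp add: nat_pow_pow)
      ultimately have "(\<Oplus>j\<in>{..<m}. ?x [^] j) = \<zero>"
        using w by (intro geometric_sum_root_of_unity) auto
      then show ?thesis using False c i by simp
    qed
    finally show "(\<Oplus>j\<in>{..<m}. c i \<otimes> ?x [^] j) = (if i = k then c k \<otimes> [m] \<cdot> \<one> else \<zero>)" .
  qed (use c k in auto)
  also have "\<dots> = c k \<otimes> [m] \<cdot> \<one>" using c k by (intro finsum_delta) auto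
  finally show ?thesis using m c[OF k] by (metis add.nat_pow_closed integral one_closed)
qed

text \<open>Such a function has \<open>\<sigma>\<close>-fixed values at the fixed points of
  \<open>\<tau>\<close> and is free on one member of each 2-cycle, which forces the other. The
  second claim says that the division by 2 is exact.\<close>

lemma card_equivariant_functions:
  assumes fin: "finite \<Omega>" "finite Y"
    and \<tau>: "\<And>c. c \<in> \<Omega> \<Longrightarrow> \<tau> c \<in> \<Omega>" "\<And>c. c \<in> \<Omega> \<Longrightarrow> \<tau> (\<tau> c) = c"
    and \<sigma>: "\<And>x. x \<in> Y \<Longrightarrow> \<sigma> x \<in> Y" "\<And>x. x \<in> Y \<Longrightarrow> \<sigma> (\<sigma> x) = x"
  defines "F \<equiv> {c \<in> \<Omega>. \<tau> c = c}"
  shows "card {v \<in> \<Omega> \<rightarrow>\<^sub>E Y. \<forall>c\<in>\<Omega>. v (\<tau> c) = \<sigma> (v c)} =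
      card {x \<in> Y. \<sigma> x = x} ^ card F * card Y ^ ((card \<Omega> - card F) div 2)" (is "card ?V = _")
    and "card \<Omega> = card F + 2 * ((card \<Omega> - card F) div 2)"
proof -
  \<comment> \<open>An arbitrary numbering; \<open>P\<close> picks the member with the smaller
    number from each 2-cycle.\<close>
  obtain h :: "'a \<Rightarrow> nat" where h: "inj_on h \<Omega>"
    using finite_imp_inj_to_nat_seg[OF fin(1)] by blast
  define P where "P = {c \<in> \<Omega>. h c < h (\<tau> c)}"
  have h_eq: "h (\<tau> c) = h c \<longleftrightarrow> \<tau> c = c" if "c \<in> \<Omega>" for c
    using h \<tau> that by (auto dest: inj_onD)
  have fins: "finite F" "finite P" using fin by (auto simp: F_def P_def)
  have disj: "F \<inter> P = {}" "(F \<union> P) \<inter> \<tau> ` P = {}"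
    using \<tau> by (auto simp: F_def P_def)
  have cases: "c \<in> F \<or> c \<in> P \<or> \<tau> c \<in> P" if "c \<in> \<Omega>" for c
    using h_eq[OF that] \<tau> that by (auto simp: F_def P_def)
  then have \<Omega>: "\<Omega> = F \<union> P \<union> \<tau> ` P" using \<tau> by (fastforce simp: F_def P_def image_iff)
  have "inj_on \<tau> P" using \<tau> by (auto simp: P_def inj_on_def) (metis)
  then have "card \<Omega> = card F + 2 * card P"
    using fins disj by (subst \<Omega>) (simp add: card_Un_disjoint card_image)
  then have cardP: "card P = (card \<Omega> - card F) div 2" by simp
  then show "card \<Omega> = card F + 2 * ((card \<Omega> - card F) div 2)" using \<open>card \<Omega> = card F + 2 * card P\<close> by simp
  define ext where "ext = (\<lambda>(a, b). \<lambda>c\<in>\<Omega>. if c \<in> F then a c else if c \<in> P then b c else \<sigma> (b (\<tau> c)))"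
  have "bij_betw (\<lambda>v. (restrict v F, restrict v P)) ?V ((F \<rightarrow>\<^sub>E {x \<in> Y. \<sigma> x = x}) \<times> (P \<rightarrow>\<^sub>E Y))"
  proof (rule bij_betw_byWitness[where f' = ext])
    show "\<forall>v\<in>?V. ext (restrict v F, restrict v P) = v"
    proof (intro ballI ext)
      fix v c assume v: "v \<in> ?V"
      show "ext (restrict v F, restrict v P) c = v c"
      proof (cases "c \<in> \<Omega>")
        case True
        then show ?thesis using v cases[OF True] disj \<tau> \<sigma> unfolding ext_def
          by (auto simp: PiE_iff)
      next
        case False
        then show ?thesis using v by (auto simp: ext_def PiE_iff extensional_def)
      qed
    qed
    show "\<forall>ab\<in>(F \<rightarrow>\<^sub>E {x \<in> Y. \<sigma> x = x}) \<times> (P \<rightarrow>\<^sub>E Y). (restrict (ext ab) F, restrict (ext ab) P) = ab"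
    proof clarify
      fix a b assume "a \<in> F \<rightarrow>\<^sub>E {x \<in> Y. \<sigma> x = x}" "b \<in> P \<rightarrow>\<^sub>E Y"
      moreover have "F \<subseteq> \<Omega>" "P \<subseteq> \<Omega>" by (auto simp: F_def P_def)
      ultimately show "restrict (ext (a, b)) F = a \<and> restrict (ext (a, b)) P = b"
        using disj by (auto simp: ext_def fun_eq_iff PiE_iff extensional_def)
    qed
    show "(\<lambda>v. (restrict v F, restrict v P)) ` ?V \<subseteq> (F \<rightarrow>\<^sub>E {x \<in> Y. \<sigma> x = x}) \<times> (P \<rightarrow>\<^sub>E Y)"
    proof (intro image_subsetI)
      fix v assume v: "v \<in> ?V"
      have "\<sigma> (v c) = v c" if "c \<in> F" for c
        using v that by (auto simp: F_def)
      then show "(restrict v F, restrict v P) \<in> (F \<rightarrow>\<^sub>E {x \<in> Y. \<sigma> x = x}) \<times> (P \<rightarrow>\<^sub>E Y)"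
        using v by (auto simp: F_def P_def)
    qed
    show "ext ` ((F \<rightarrow>\<^sub>E {x \<in> Y. \<sigma> x = x}) \<times> (P \<rightarrow>\<^sub>E Y)) \<subseteq> ?V"
    proof (intro image_subsetI)
      fix ab assume "ab \<in> (F \<rightarrow>\<^sub>E {x \<in> Y. \<sigma> x = x}) \<times> (P \<rightarrow>\<^sub>E Y)"
      then obtain a b where ab: "ab = (a, b)" and a: "\<And>c. c \<in> F \<Longrightarrow> a c \<in> Y \<and> \<sigma> (a c) = a c"
        and b: "\<And>c. c \<in> P \<Longrightarrow> b c \<in> Y" by (auto simp: PiE_iff)
      have "ext (a, b) c \<in> Y \<and> ext (a, b) (\<tau> c) = \<sigma> (ext (a, b) c)" if c: "c \<in> \<Omega>" for c
      proof -
        consider "c \<in> F" | "c \<in> P" | "\<tau> c \<in> P" using cases[OF c] by blast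
        then show ?thesis
        proof cases
          case 1
          then show ?thesis using a[OF 1] c by (auto simp: ext_def F_def)
        next
          case 2
          then have "\<tau> c \<notin> F" "\<tau> c \<notin> P" "c \<notin> F" using disj by auto
          then show ?thesis using 2 b[OF 2] c \<tau> \<sigma> by (auto simp: ext_def)
        next
          case 3
          then have "c \<notin> F" "\<tau> c \<notin> F" using disj(1) by (auto simp: F_def)
          moreover have "c \<notin> P" using 3 disj(2) \<tau>(2)[OF c] by (metis IntI UnI2 empty_iff image_eqI)
          ultimately have "c \<notin> F" "c \<notin> P" "\<tau> c \<notin> F" by auto
          then show ?thesis using 3 b[OF 3] c \<tau> \<sigma> by (auto simp: ext_def)
        qed
      qed
      then show "ext ab \<in> ?V" by (auto simp: ab) (auto simp: ext_def)
    qed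
  qed
  then have "card ?V = card ((F \<rightarrow>\<^sub>E {x \<in> Y. \<sigma> x = x}) \<times> (P \<rightarrow>\<^sub>E Y))" by (rule bij_betw_same_card)
  then show "card ?V = card {x \<in> Y. \<sigma> x = x} ^ card F * card Y ^ ((card \<Omega> - card F) div 2)"
    using fins by (simp add: card_cartesian_product card_PiE cardP)
qed

text \<open>The characters embed the group algebra into the vectors \<open>v\<close> with \<open>v (\<tau> c) = \<sigma> (v c)\<close>. There are
  as many of these as elements of the algebra, so the embedding is onto.\<close>

theorem (in finite_group_algebra) card_torsion_units_characters:
  assumes R: "field R" "finite (carrier R)" and K: "field K" "finite (carrier K)"
    and card_K: "card (carrier K) = card (carrier R) ^ 2"
    and h: "ring_hom_cring R K h" "inj_on h (carrier R)"
    and \<sigma>: "ring_hom_cring K K \<sigma>" "\<And>x. x \<in> carrier K \<Longrightarrow> \<sigma> (\<sigma> x) = x"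
    and fixed: "{x \<in> carrier K. \<sigma> x = x} = h ` carrier R"
    and \<Omega>: "finite \<Omega>" "card \<Omega> = card (carrier G)"
    and \<tau>: "\<And>c. c \<in> \<Omega> \<Longrightarrow> \<tau> c \<in> \<Omega>" "\<And>c. c \<in> \<Omega> \<Longrightarrow> \<tau> (\<tau> c) = c"
    and \<chi>: "\<And>c x. c \<in> \<Omega> \<Longrightarrow> x \<in> carrier G \<Longrightarrow> \<chi> c x \<in> carrier K"
      "\<And>c. c \<in> \<Omega> \<Longrightarrow> \<chi> c \<one>\<^bsub>G\<^esub> = \<one>\<^bsub>K\<^esub>"
      "\<And>c x y. c \<in> \<Omega> \<Longrightarrow> x \<in> carrier G \<Longrightarrow> y \<in> carrier G \<Longrightarrow> \<chi> c (x \<otimes>\<^bsub>G\<^esub> y) = \<chi> c x \<otimes>\<^bsub>K\<^esub> \<chi> c y"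
      "\<And>c x. c \<in> \<Omega> \<Longrightarrow> x \<in> carrier G \<Longrightarrow> \<sigma> (\<chi> c x) = \<chi> (\<tau> c) x"
    and separating: "\<And>f. f \<in> carrier A \<Longrightarrow>
      (\<And>c. c \<in> \<Omega> \<Longrightarrow> (\<Oplus>\<^bsub>K\<^esub>x\<in>carrier G. h (f x) \<otimes>\<^bsub>K\<^esub> \<chi> c x) = \<zero>\<^bsub>K\<^esub>) \<Longrightarrow>
      \<forall>x\<in>carrier G. f x = \<zero>"
    and d: "d > 0"
  defines "m \<equiv> card {c \<in> \<Omega>. \<tau> c = c}"
  shows "card (torsion (units_of A) d) = gcd d (card (carrier R) - 1) ^ m *
    gcd d (card (carrier R) ^ 2 - 1) ^ ((card (carrier G) - m) div 2)"
proof -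
  interpret RF: field R by fact
  interpret K: field K by fact
  interpret h: ring_hom_cring R K h by fact
  interpret \<sigma>: ring_hom_cring K K \<sigma> by fact
  define ev where "ev c f = (\<Oplus>\<^bsub>K\<^esub>x\<in>carrier G. h (f x) \<otimes>\<^bsub>K\<^esub> \<chi> c x)" for c f
  have ev_hom: "ring_hom_cring A K (ev c)" if "c \<in> \<Omega>" for c
    unfolding ev_def
    by (rule ring_hom_cringI[OF cring_A K.is_cring ring_hom_evaluation[OF h(1)]]) (use that \<chi> in auto)
  have ev_closed: "ev c f \<in> carrier K" and ev_pow: "ev c (f [^]\<^bsub>A\<^esub> n) = ev c f [^]\<^bsub>K\<^esub> n"
    and ev_one: "ev c \<one>\<^bsub>A\<^esub> = \<one>\<^bsub>K\<^esub>" if "c \<in> \<Omega>" "f \<in> carrier A" for c f and n :: nat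
  proof -
    interpret e: ring_hom_cring A K "ev c" using that(1) by (rule ev_hom)
    show "ev c f \<in> carrier K" "ev c (f [^]\<^bsub>A\<^esub> n) = ev c f [^]\<^bsub>K\<^esub> n" "ev c \<one>\<^bsub>A\<^esub> = \<one>\<^bsub>K\<^esub>"
      using that(2) by simp_all
  qed
  have hfix: "\<sigma> (h a) = h a" if "a \<in> carrier R" for a using fixed that by blast
  \<comment> \<open>\<open>\<sigma>\<close> passes through the sum, fixes the coefficients, which
    come from \<open>R\<close>, and permutes the characters.\<close>
  have ev_\<tau>: "ev (\<tau> c) f = \<sigma> (ev c f)" if "c \<in> \<Omega>" "f \<in> carrier A" for c f
  proof -
    have "\<sigma> (ev c f) = (\<Oplus>\<^bsub>K\<^esub>x\<in>carrier G. (\<sigma> \<circ> (\<lambda>x. h (f x) \<otimes>\<^bsub>K\<^esub> \<chi> c x)) x)"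
      unfolding ev_def using that \<chi>(1) by (subst \<sigma>.hom_finsum) (auto simp: A_apply o_def)
    also have "\<dots> = ev (\<tau> c) f"
      unfolding ev_def using that \<chi>(1,4) \<tau>(1) hfix by (intro K.finsum_cong') (auto simp: A_apply)
    finally show ?thesis by simp
  qed
  define \<Phi> where "\<Phi> f = (\<lambda>c\<in>\<Omega>. ev c f)" for f
  define V where "V Y = {v \<in> \<Omega> \<rightarrow>\<^sub>E Y. \<forall>c\<in>\<Omega>. v (\<tau> c) = \<sigma> (v c)}" for Y
  have inj: "inj_on \<Phi> (carrier A)"
  proof (rule inj_onI)
    fix f g assume fg: "f \<in> carrier A" "g \<in> carrier A" "\<Phi> f = \<Phi> g"
    have "ev c (f \<ominus>\<^bsub>A\<^esub> g) = \<zero>\<^bsub>K\<^esub>" if c: "c \<in> \<Omega>" for c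
    proof -
      interpret e: ring_hom_cring A K "ev c" using c by (rule ev_hom)
      have "ev c f = ev c g" using fg(3) c unfolding \<Phi>_def by (metis restrict_apply')
      then show ?thesis using fg ev_closed[OF c] by (simp add: a_minus_def K.r_neg)
    qed
    then have "\<forall>x\<in>carrier G. (f \<ominus>\<^bsub>A\<^esub> g) x = \<zero>"
      using fg by (intro separating) (auto simp: ev_def)
    then have "f \<ominus>\<^bsub>A\<^esub> g = \<zero>\<^bsub>A\<^esub>"
      using fg by (intro A_eqI) (simp_all add: zero_A[symmetric], simp add: zero_A)
    then show "f = g" using fg by simp
  qed
  have into: "\<Phi> f \<in> V (carrier K)" if "f \<in> carrier A" for f
    using that ev_closed ev_\<tau> \<tau>(1) by (auto simp: V_def \<Phi>_def)
  note count = card_equivariant_functions[OF \<Omega>(1) _ \<tau>, folded m_def]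
  have fixed_card: "card {x \<in> carrier K. \<sigma> x = x} = card (carrier R)"
    unfolding fixed using h(2) by (rule card_image)
  have G_eq: "card (carrier G) = m + 2 * ((card (carrier G) - m) div 2)"
    using count(2)[of "carrier K" \<sigma>] K(2) \<sigma>(2) \<Omega>(2) by simp
  have "card (V (carrier K)) = card (carrier R) ^ m * (card (carrier R) ^ 2) ^ ((card (carrier G) - m) div 2)"
    using count(1)[of "carrier K" \<sigma>] K(2) \<sigma>(2) \<Omega>(2) fixed_card card_K by (simp add: V_def)
  also have "\<dots> = card (carrier R) ^ card (carrier G)"
    using arg_cong[OF G_eq, of "\<lambda>k. card (carrier R) ^ k"] by (simp only: power_add power_mult)
  also have "\<dots> = card (carrier A)" using finite_G by (simp add: carrier_A card_PiE)
  finally have card_V: "card (V (carrier K)) = card (carrier A)" .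
  have "finite (V (carrier K))"
    unfolding V_def using \<Omega>(1) K(2) by (intro finite_Collect_conjI disjI1) (simp add: finite_PiE)
  then have surj: "\<Phi> ` carrier A = V (carrier K)"
    using into inj card_V by (intro card_subset_eq) (auto simp: card_image)
  \<comment> \<open>Powers are taken coordinatewise, so the solutions of f^d = 1 correspond to the
    equivariant vectors with values in \<open>?Y\<close>. The same count applies with
    \<open>?Y\<close> in place of \<open>K\<close>.\<close>
  let ?Y = "{a \<in> carrier K. a [^]\<^bsub>K\<^esub> d = \<one>\<^bsub>K\<^esub>}"
  have pow_iff: "f [^]\<^bsub>A\<^esub> d = \<one>\<^bsub>A\<^esub> \<longleftrightarrow> (\<forall>c\<in>\<Omega>. ev c f [^]\<^bsub>K\<^esub> d = \<one>\<^bsub>K\<^esub>)" if f: "f \<in> carrier A" for f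
  proof -
    have "f [^]\<^bsub>A\<^esub> d = \<one>\<^bsub>A\<^esub> \<longleftrightarrow> \<Phi> (f [^]\<^bsub>A\<^esub> d) = \<Phi> \<one>\<^bsub>A\<^esub>"
      using inj f by (auto dest: inj_onD)
    also have "\<dots> \<longleftrightarrow> (\<forall>c\<in>\<Omega>. ev c (f [^]\<^bsub>A\<^esub> d) = ev c \<one>\<^bsub>A\<^esub>)"
      unfolding \<Phi>_def by (auto simp: fun_eq_iff)
    finally show ?thesis using f by (simp add: ev_pow ev_one)
  qed
  have "\<Phi> ` {f \<in> carrier A. f [^]\<^bsub>A\<^esub> d = \<one>\<^bsub>A\<^esub>} = V ?Y"
  proof (intro equalityI subsetI)
    fix v assume "v \<in> \<Phi> ` {f \<in> carrier A. f [^]\<^bsub>A\<^esub> d = \<one>\<^bsub>A\<^esub>}"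
    then obtain f where f: "f \<in> carrier A" "f [^]\<^bsub>A\<^esub> d = \<one>\<^bsub>A\<^esub>" "v = \<Phi> f" by auto
    then have "\<forall>c\<in>\<Omega>. ev c f \<in> ?Y" using pow_iff ev_closed by auto
    then show "v \<in> V ?Y" using into[OF f(1)] f(3) by (auto simp: V_def \<Phi>_def)
  next
    fix v assume v: "v \<in> V ?Y"
    then have "v \<in> V (carrier K)" by (auto simp: V_def)
    then obtain f where f: "f \<in> carrier A" "v = \<Phi> f" using surj by auto
    have "\<forall>c\<in>\<Omega>. ev c f [^]\<^bsub>K\<^esub> d = \<one>\<^bsub>K\<^esub>" using v f(2) by (auto simp: V_def \<Phi>_def PiE_iff)
    then show "v \<in> \<Phi> ` {f \<in> carrier A. f [^]\<^bsub>A\<^esub> d = \<one>\<^bsub>A\<^esub>}" using f pow_iff by auto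
  qed
  then have "card (V ?Y) = card (\<Phi> ` {f \<in> carrier A. f [^]\<^bsub>A\<^esub> d = \<one>\<^bsub>A\<^esub>})" by simp
  also have "\<dots> = card {f \<in> carrier A. f [^]\<^bsub>A\<^esub> d = \<one>\<^bsub>A\<^esub>}"
    by (intro card_image inj_on_subset[OF inj]) auto
  finally have "card (torsion (units_of A) d) = card (V ?Y)"
    by (simp add: A.torsion_units_of[OF d])
  also have "\<dots> = card {x \<in> ?Y. \<sigma> x = x} ^ m * card ?Y ^ ((card \<Omega> - m) div 2)"
    unfolding V_def
  proof (rule count(1))
    show "finite ?Y" using K(2) by simp
    fix x assume "x \<in> ?Y"
    then show "\<sigma> x \<in> ?Y" "\<sigma> (\<sigma> x) = x" using \<sigma>.hom_pow[of x d] \<sigma>(2) by auto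
  qed
  also have "card ?Y = gcd d (card (carrier R) ^ 2 - 1)"
    using K.card_torsion_units_of[OF K(2), of d] by (simp add: K.torsion_units_of[OF d] card_K)
  \<comment> \<open>Fixed elements of \<open>K\<close> come from \<open>R\<close>, so these are the
    d-th roots of unity of the smaller field.\<close>
  also have "card {x \<in> ?Y. \<sigma> x = x} = gcd d (card (carrier R) - 1)"
  proof -
    have "{x \<in> ?Y. \<sigma> x = x} = h ` {a \<in> carrier R. a [^] d = \<one>}"
    proof -
      have iff: "h a [^]\<^bsub>K\<^esub> d = \<one>\<^bsub>K\<^esub> \<longleftrightarrow> a [^] d = \<one>" if "a \<in> carrier R" for a
        using that by (metis h(2) h.hom_one h.hom_pow inj_onD R.nat_pow_closed R.one_closed)
      have "{x \<in> ?Y. \<sigma> x = x} = {x \<in> {x \<in> carrier K. \<sigma> x = x}. x [^]\<^bsub>K\<^esub> d = \<one>\<^bsub>K\<^esub>}" by auto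
      also have "\<dots> = h ` {a \<in> carrier R. a [^] d = \<one>}" unfolding fixed using iff by auto
      finally show ?thesis .
    qed
    moreover have "inj_on h {a \<in> carrier R. a [^] d = \<one>}" using h(2) by (rule inj_on_subset) auto
    ultimately show ?thesis
      using RF.card_torsion_units_of[OF R(2), of d] by (simp add: R.torsion_units_of[OF d] card_image)
  qed
  finally show ?thesis unfolding \<Omega>(2) .
qed

section \<open>Roots of unity in finite fields and their conjugates\<close>

lemma (in group) pow_eq_pow_iff:
  fixes i j :: nat
  assumes "x \<in> carrier G"
  shows "x [^] i = x [^] j \<longleftrightarrow> i mod ord x = j mod ord x"
proof -
  have "x [^] i = x [^] j \<longleftrightarrow> int (ord x) dvd int j - int i"
    using int_pow_eq[OF assms, of "int i" "int j"] by (simp add: int_pow_int)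
  also have "\<dots> \<longleftrightarrow> int j mod int (ord x) = int i mod int (ord x)"
    by (simp add: mod_eq_dvd_iff)
  finally show ?thesis by (metis of_nat_eq_iff zmod_int)
qed

text \<open>If m l is the order of the multiplicative group, the l-th power of a generator has order
  m. Primitivity is phrased as a rule for comparing two powers, since character values are compared
  through their exponents.\<close>

lemma (in field) exists_root_of_unity:
  fixes m :: nat
  assumes fin: "finite (carrier R)" and m: "m > 0" "m dvd card (carrier R) - 1"
  shows "\<exists>w\<in>carrier R. \<forall>i j :: nat. w [^] i = w [^] j \<longleftrightarrow> i mod m = j mod m"
proof -
  interpret U: group "units_of R" by (rule units_group)
  obtain a where a: "a \<in> carrier (units_of R)" "U.ord a = card (carrier R) - 1"
    using ex_units_generator[OF fin] order_units_of[OF fin] by metis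
  obtain l where l: "card (carrier R) - 1 = m * l" using m by auto
  \<comment> \<open>A field has at least two elements, so the multiplicative group has positive
    order and l is not 0.\<close>
  have "{\<zero>, \<one>} \<subseteq> carrier R" by simp
  then have "card {\<zero>, \<one>} \<le> card (carrier R)" using fin by (rule card_mono[rotated])
  then have "l > 0" using l by (cases l) auto
  define w where "w = a [^]\<^bsub>units_of R\<^esub> l"
  have w: "w \<in> carrier (units_of R)" using a by (simp add: w_def)
  have "U.ord w = m" unfolding w_def using a l \<open>l > 0\<close> by (subst U.ord_pow) auto
  then have "w [^]\<^bsub>units_of R\<^esub> i = w [^]\<^bsub>units_of R\<^esub> j \<longleftrightarrow> i mod m = j mod m" for i j :: nat
    using U.pow_eq_pow_iff[OF w] by simp
  moreover have "w \<in> Units R" using w by (simp add: units_of_carrier)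
  ultimately show ?thesis by (auto simp: units_of_pow)
qed

text \<open>Being fixed means lying in the smaller field, whose nonzero elements have order dividing
  its cardinality minus 1. Conversely, if m divides that number, the smaller field already has m
  roots of x^m = 1, and \<open>K\<close> has no more.\<close>

lemma conjugation_fixes_root_of_unity_iff:
  fixes m :: nat
  assumes R: "field R" "finite (carrier R)" and K: "field K" "finite (carrier K)"
    and h: "ring_hom_cring R K h" "inj_on h (carrier R)"
    and fixed: "{x \<in> carrier K. \<sigma> x = x} = h ` carrier R"
    and w: "w \<in> carrier K" "\<And>n :: nat. w [^]\<^bsub>K\<^esub> n = \<one>\<^bsub>K\<^esub> \<longleftrightarrow> m dvd n" and m: "m > 0"
  shows "\<sigma> w = w \<longleftrightarrow> m dvd card (carrier R) - 1"
proof -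
  interpret R: field R by fact
  interpret K: field K by fact
  interpret h: ring_hom_cring R K h by fact
  have iff: "h a [^]\<^bsub>K\<^esub> n = \<one>\<^bsub>K\<^esub> \<longleftrightarrow> a [^]\<^bsub>R\<^esub> n = \<one>\<^bsub>R\<^esub>" if "a \<in> carrier R" for a and n :: nat
    using that by (metis h(2) h.hom_one h.hom_pow inj_onD R.nat_pow_closed R.one_closed)
  show ?thesis
  proof
    assume "\<sigma> w = w"
    then obtain a where a: "a \<in> carrier R" "w = h a" using w(1) fixed by blast
    interpret U: group "units_of R" by (rule R.units_group)
    have "a \<in> Units R" using w(2)[of m] iff a m by (intro R.pow_eq_one_imp_Units[of a m]) auto
    moreover have "order (units_of R) = card (carrier R) - 1" using R(2) by (rule R.order_units_of)
    ultimately have "a [^]\<^bsub>R\<^esub> (card (carrier R) - 1) = \<one>\<^bsub>R\<^esub>"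
      using U.pow_order_eq_1[of a] by (simp add: units_of_carrier R.units_of_pow units_of_one)
    then show "m dvd card (carrier R) - 1" using w(2) iff a by blast
  next
    assume dvd: "m dvd card (carrier R) - 1"
    let ?T = "{x \<in> carrier K. x [^]\<^bsub>K\<^esub> m = \<one>\<^bsub>K\<^esub>}" and ?S = "{a \<in> carrier R. a [^]\<^bsub>R\<^esub> m = \<one>\<^bsub>R\<^esub>}"
    have "card ?S = m"
      using R.card_torsion_units_of[OF R(2), of m] dvd by (simp add: R.torsion_units_of[OF m] gcd_nat.absorb1)
    moreover have "inj_on h ?S" using h(2) by (rule inj_on_subset) auto
    ultimately have "card (h ` ?S) = m" by (simp add: card_image)
    moreover have "card ?T \<le> m"
      using K.card_torsion_units_of[OF K(2), of m] m by (simp add: K.torsion_units_of[OF m] gcd_le1_nat)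
    moreover have "h ` ?S \<subseteq> ?T" using iff by auto
    ultimately have "h ` ?S = ?T" using K(2) by (intro card_seteq) auto
    moreover have "w \<in> ?T" using w by simp
    ultimately have "w \<in> h ` carrier R" by blast
    then show "\<sigma> w = w" using fixed by blast
  qed
qed

section \<open>The group \<open>C\<^sub>8 \<times> C\<^sub>4\<close>\<close>

lemma comm_group_DirProd:
  assumes "comm_group G" "comm_group H"
  shows "comm_group (G \<times>\<times> H)"
proof -
  interpret G: comm_group G by fact
  interpret H: comm_group H by fact
  interpret group "G \<times>\<times> H" by (intro DirProd_group G.is_group H.is_group)
  show ?thesis by (rule group_comm_groupI) (auto simp: G.m_comm H.m_comm)
qed

lemma comm_group_product_group:
  assumes "\<And>i. i \<in> I \<Longrightarrow> comm_group (G i)"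
  shows "comm_group (product_group I G)"
proof -
  interpret group "product_group I G" using assms by (simp add: comm_group.axioms)
  show ?thesis
    by (rule group_comm_groupI)
      (use assms in \<open>auto simp: PiE_iff fun_eq_iff intro!: restrict_ext comm_monoid.m_comm comm_group.axioms\<close>)
qed

lemma comm_group_cyclic_power: "comm_group (cyclic_power m k)"
  by (rule comm_group_product_group) simp

lemma finite_cyclic_power: "m > 0 \<Longrightarrow> finite (carrier (cyclic_power m k))"
  by (auto simp: carrier_integer_mod_group intro!: finite_PiE)

lemma comm_group_cyclic_8_4: "comm_group (cyclic 8 \<times>\<times> cyclic 4)"
  by (simp add: comm_group_DirProd)

lemma carrier_cyclic_8_4: "carrier (cyclic 8 \<times>\<times> cyclic 4) = {0..<8} \<times> {0..<4}"
  by (simp add: carrier_integer_mod_group)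

lemma finite_group_algebra_cyclic_8_4:
  assumes "cring F"
  shows "finite_group_algebra F (cyclic 8 \<times>\<times> cyclic 4)"
  unfolding finite_group_algebra_def finite_group_algebra_axioms_def
  using assms comm_group_cyclic_8_4 by (simp add: carrier_integer_mod_group)

lemma (in ring) add_pow_one_eq_zero_iff:
  "[n] \<cdot> \<one> = \<zero> \<longleftrightarrow> ring_char R dvd (n :: nat)"
  unfolding ring_char_def using group.pow_eq_id[OF a_group, of \<one> n] by (simp add: add_pow_def)

lemma (in ring) one_plus_one_eq_zero_iff: "\<one> \<oplus> \<one> = \<zero> \<longleftrightarrow> ring_char R dvd 2"
  using add_pow_one_eq_zero_iff[of 2] by (simp add: numeral_2_eq_2)

text \<open>The images for k = 0, 1, 2, 3 have 8 * 4, 4 * 2, 2 * 1 and 1 * 1 elements.\<close>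

lemma card_pow_image_cyclic_8_4:
  "k \<le> 3 \<Longrightarrow> card ((\<lambda>x. x [^]\<^bsub>cyclic 8 \<times>\<times> cyclic 4\<^esub> (2 ^ k :: nat)) ` carrier (cyclic 8 \<times>\<times> cyclic 4)) =
    [32, 8, 2, 1] ! k"
proof -
  assume "k \<le> 3"
  have "(\<lambda>x. x [^]\<^bsub>cyclic 8 \<times>\<times> cyclic 4\<^esub> (2 ^ k :: nat)) ` carrier (cyclic 8 \<times>\<times> cyclic 4) =
      (\<lambda>x. (2 ^ k * x) mod 8) ` {0..<8} \<times> (\<lambda>y. (2 ^ k * y) mod 4) ` {0..<4}"
  proof -
    have "(\<lambda>x. x [^]\<^bsub>cyclic 8 \<times>\<times> cyclic 4\<^esub> (2 ^ k :: nat)) =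
        (\<lambda>(x, y). ((2 ^ k * x) mod 8, (2 ^ k * y) mod 4))"
      by (auto simp: fun_eq_iff pow_DirProd)
    then show ?thesis unfolding carrier_cyclic_8_4 by (simp only: image_paired_Times)
  qed
  moreover have "{0..<8} = {0, 1, 2, 3, 4, 5, 6, 7 :: int}" "{0..<4} = {0, 1, 2, 3 :: int}" by auto
  moreover have "k = 0 \<or> k = 1 \<or> k = 2 \<or> k = 3" using \<open>k \<le> 3\<close> by auto
  ultimately show ?thesis by (elim disjE) (simp_all add: card_cartesian_product card_insert_if)
qed

section \<open>Counts for C_8 x C_4 in characteristic 2\<close>

lemma card_torsion_units_char_2:
  assumes F: "field F" "finite (carrier F)" "ring_char F = 2" "card (carrier F) = 2 ^ n" and d: "d > 0"
  shows "card (torsion (units_of (group_algebra F (cyclic 8 \<times>\<times> cyclic 4))) d) =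
    gcd d 8 ^ n * gcd d 4 ^ (5 * n) * gcd d 2 ^ (18 * n) * gcd d (2 ^ n - 1)"
proof -
  interpret field F by fact
  let ?G = "cyclic 8 \<times>\<times> cyclic 4"
  interpret finite_group_algebra F ?G by (rule finite_group_algebra_cyclic_8_4[OF is_cring])
  interpret modular_group_algebra F ?G 3
  proof unfold_locales
    show "\<one>\<^bsub>F\<^esub> \<oplus>\<^bsub>F\<^esub> \<one>\<^bsub>F\<^esub> = \<zero>\<^bsub>F\<^esub>" using F(3) one_plus_one_eq_zero_iff by simp
    fix x assume "x \<in> carrier ?G"
    then show "x [^]\<^bsub>?G\<^esub> (2 ^ 3 :: nat) = \<one>\<^bsub>?G\<^esub>"
      by (auto simp: pow_DirProd)
  qed (fact F(2))
  obtain k where k: "k \<le> 3" "gcd d 8 = 2 ^ k"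
    using divides_primepow_nat[of 2 "gcd d 8" 3] by auto
  \<comment> \<open>All gcds with 8, 4 and 2 depend on \<open>gcd d 8\<close> only, which leaves
    four cases.\<close>
  have g4: "gcd d 4 = gcd (gcd d 8) 4" and g2: "gcd d 2 = gcd (gcd d 8) 2"
    by (simp_all add: gcd.assoc)
  have "card (carrier ?G) = 32" by (simp add: carrier_integer_mod_group card_cartesian_product)
  then have "card (torsion (units_of A) d) = (2 ^ n) ^ (32 - [32, 8, 2, 1] ! k) * gcd d (2 ^ n - 1)"
    using card_torsion_units_eq[OF d] card_pow_image_cyclic_8_4[OF k(1)] k(2) by (simp add: F(4))
  \<comment> \<open>For k = 0, 1, 2, 3 the exponents of 2^n on the left are 0, 24, 30, 31; on the
    right they are 0, 1 + 5 + 18, 2 + 10 + 18 and 3 + 10 + 18.\<close>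
  also have "(2 ^ n) ^ (32 - [32, 8, 2, 1] ! k) = gcd d 8 ^ n * gcd d 4 ^ (5 * n) * gcd d 2 ^ (18 * n)"
  proof -
    have four: "(4 :: nat) ^ j = 2 ^ (2 * j)" and eight: "(8 :: nat) ^ j = 2 ^ (3 * j)" for j
      by (simp_all add: power_mult)
    have "k = 0 \<or> k = 1 \<or> k = 2 \<or> k = 3" using k(1) by auto
    then show ?thesis
      unfolding g4 g2 k(2)
      by (elim disjE) (simp_all add: four eight flip: power_mult power_add)
  qed
  finally show ?thesis .
qed

section \<open>Counts for C_8 x C_4 in odd characteristic\<close>

lemma card_fixed_multiplication_8_4:
  fixes t :: nat
  assumes "t = 1 \<or> t = 3 \<or> t = 5 \<or> t = 7"
  shows "card {c \<in> {..<8} \<times> {..<4}. (t * fst c mod 8, t * snd c mod 4) = c} =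
    (if t = 1 then 32 else if t = 5 then 16 else 4)"
proof -
  have "{c \<in> {..<8} \<times> {..<4}. (t * fst c mod 8, t * snd c mod 4) = c} =
      {r \<in> {..<8}. t * r mod 8 = r} \<times> {s \<in> {..<4}. t * s mod 4 = s}" by auto
  moreover have sum: "card {r \<in> I. P r} = (\<Sum>r\<in>I. if P r then 1 else 0)" if "finite I" for I :: "nat set" and P
    using that by (simp add: sum.If_cases Int_def)
  have "card {r \<in> {..<8}. t * r mod 8 = r} = (\<Sum>r\<in>{0, 1, 2, 3, 4, 5, 6, 7}. if t * r mod 8 = r then 1 else 0)"
    unfolding sum[OF finite_lessThan] by (rule sum.cong) auto
  moreover have "card {s \<in> {..<4}. t * s mod 4 = s} = (\<Sum>s\<in>{0, 1, 2, 3}. if t * s mod 4 = s then 1 else 0)"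
    unfolding sum[OF finite_lessThan] by (rule sum.cong) auto
  ultimately have "card {c \<in> {..<8} \<times> {..<4}. (t * fst c mod 8, t * snd c mod 4) = c} =
      (\<Sum>r\<in>{0, 1, 2, 3, 4, 5, 6, 7}. if t * r mod 8 = r then 1 else 0) *
      (\<Sum>s\<in>{0, 1, 2, 3}. if t * s mod 4 = s then 1 else 0)"
    by (simp only: card_cartesian_product)
  \<comment> \<open>The fixed set is a product, and each factor has been written as a finite sum of
    indicators that evaluates for each t: 8 * 4 for t = 1, 4 * 4 for t = 5 and 2 * 2 for t = 3,
    7.\<close>
  then show ?thesis using assms by (elim disjE) simp_all
qed

text \<open>\<open>m\<close> is the number of characters fixed by conjugation; each of the (32 -
  m)/2 conjugate pairs contributes a cyclic group of order q^2 - 1.\<close>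

lemma card_torsion_units_odd:
  assumes F: "field F" "finite (carrier F)" "\<one>\<^bsub>F\<^esub> \<oplus>\<^bsub>F\<^esub> \<one>\<^bsub>F\<^esub> \<noteq> \<zero>\<^bsub>F\<^esub>"
    and q: "card (carrier F) = q" "odd q" and d: "d > 0"
  defines "m \<equiv> if 8 dvd q - 1 then 32 else if 4 dvd q - 1 then 16 else 4"
  shows "card (torsion (units_of (group_algebra F (cyclic 8 \<times>\<times> cyclic 4))) d) =
    gcd d (q - 1) ^ m * gcd d (q ^ 2 - 1) ^ ((32 - m) div 2)"
proof -
  interpret F: field F by fact
  let ?G = "cyclic 8 \<times>\<times> cyclic 4"
  interpret finite_group_algebra F ?G by (rule finite_group_algebra_cyclic_8_4[OF F.is_cring])
  obtain r where r: "r \<in> carrier F" "\<And>x. x \<in> carrier F \<Longrightarrow> x \<otimes>\<^bsub>F\<^esub> x \<noteq> r"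
    using F.exists_nonsquare[OF F(2,3)] by blast
  define K where "K = quadratic_extension F r"
  define h where "h a = (a, \<zero>\<^bsub>F\<^esub>)" for a :: 'a
  define \<sigma> where "\<sigma> = (\<lambda>(a :: 'a, b). (a, \<ominus>\<^bsub>F\<^esub> b))"
  note K_simps = quadratic_extension_simps[of F r, folded K_def]
  interpret K: field K unfolding K_def using r by (rule F.quadratic_extension_field)
  have h: "ring_hom_cring F K h"
    using F.quadratic_extension_embedding[OF r(1)] unfolding K_def h_def .
  interpret h: ring_hom_cring F K h by (rule h)
  have inj_h: "inj_on h (carrier F)" by (auto simp: h_def inj_on_def)
  have \<sigma>: "ring_hom_cring K K \<sigma>"
    using F.quadratic_extension_conjugation[OF r(1)] unfolding K_def \<sigma>_def .
  interpret \<sigma>: ring_hom_cring K K \<sigma> by (rule \<sigma>)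
  have \<sigma>\<sigma>: "\<sigma> (\<sigma> x) = x" if "x \<in> carrier K" for x using that by (auto simp: \<sigma>_def K_simps)
  have double: "b = \<zero>\<^bsub>F\<^esub>" if b: "b \<in> carrier F" "\<ominus>\<^bsub>F\<^esub> b = b" for b
  proof -
    have "b \<oplus>\<^bsub>F\<^esub> b = \<zero>\<^bsub>F\<^esub>" using b F.r_neg[of b] by simp
    then have "(\<one>\<^bsub>F\<^esub> \<oplus>\<^bsub>F\<^esub> \<one>\<^bsub>F\<^esub>) \<otimes>\<^bsub>F\<^esub> b = \<zero>\<^bsub>F\<^esub>" using b by (simp add: F.l_distr)
    then show ?thesis using F(3) b by (simp add: F.integral_iff)
  qed
  have fixed: "{x \<in> carrier K. \<sigma> x = x} = h ` carrier F"
    using double by (auto simp: \<sigma>_def h_def K_simps image_iff)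
  have fin_K: "finite (carrier K)" and card_K: "card (carrier K) = card (carrier F) ^ 2"
    using F(2) by (simp_all add: K_simps card_cartesian_product power2_eq_square)
  \<comment> \<open>For q = 2 k + 1 one has q^2 - 1 = 4 k (k + 1), and k (k + 1) is even.\<close>
  have "8 dvd card (carrier K) - 1"
  proof -
    obtain k where "q = 2 * k + 1" using q(2) by (elim oddE)
    then have "card (carrier K) - 1 = 4 * (k * (k + 1))"
      using card_K q(1) by (simp add: power2_eq_square algebra_simps)
    moreover have "even (k * (k + 1))" by simp
    then have "4 * 2 dvd 4 * (k * (k + 1))" by (rule mult_dvd_mono[OF dvd_refl])
    ultimately show ?thesis by simp
  qed
  then obtain w where w: "w \<in> carrier K"
    and w_eq: "\<And>i j :: nat. w [^]\<^bsub>K\<^esub> i = w [^]\<^bsub>K\<^esub> j \<longleftrightarrow> i mod 8 = j mod 8"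
    using K.exists_root_of_unity[OF fin_K, of 8] by auto
  have w_one: "w [^]\<^bsub>K\<^esub> n = \<one>\<^bsub>K\<^esub> \<longleftrightarrow> 8 dvd n" for n :: nat
    using w_eq[of n 0] by (simp add: mod_eq_0_iff_dvd)
  have w2: "w [^]\<^bsub>K\<^esub> (2::nat) \<in> carrier K"
    "(w [^]\<^bsub>K\<^esub> (2::nat)) [^]\<^bsub>K\<^esub> n = \<one>\<^bsub>K\<^esub> \<longleftrightarrow> 4 dvd n" for n :: nat
  proof -
    have "8 dvd 2 * n \<longleftrightarrow> 4 dvd n" by presburger
    then show "(w [^]\<^bsub>K\<^esub> (2::nat)) [^]\<^bsub>K\<^esub> n = \<one>\<^bsub>K\<^esub> \<longleftrightarrow> 4 dvd n"
      using w by (simp add: K.nat_pow_pow w_one)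
  qed (use w in simp)
  \<comment> \<open>\<open>K\<close> has at most 8 eighth roots of unity, so the powers of w are all
    of them, and the conjugate of w is one of these powers.\<close>
  obtain t :: nat where t8: "t < 8" and \<sigma>w: "\<sigma> w = w [^]\<^bsub>K\<^esub> t"
  proof -
    let ?T = "{x \<in> carrier K. x [^]\<^bsub>K\<^esub> (8::nat) = \<one>\<^bsub>K\<^esub>}"
    have "(\<lambda>i::nat. w [^]\<^bsub>K\<^esub> i) ` {..<8} \<subseteq> ?T" using w by (auto simp: K.nat_pow_pow w_one)
    moreover have "inj_on (\<lambda>i::nat. w [^]\<^bsub>K\<^esub> i) {..<8}" by (auto simp: inj_on_def w_eq)
    moreover have "card ?T \<le> 8"
      using K.card_torsion_units_of[OF fin_K, of 8] by (simp add: K.torsion_units_of gcd_le1_nat)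
    ultimately have "(\<lambda>i::nat. w [^]\<^bsub>K\<^esub> i) ` {..<8} = ?T"
      using fin_K by (intro card_seteq) (auto simp: card_image)
    moreover have "\<sigma> w \<in> ?T" using w w_one[of 8] \<sigma>.hom_pow[of w 8] by simp
    ultimately have "\<sigma> w \<in> (\<lambda>i::nat. w [^]\<^bsub>K\<^esub> i) ` {..<8}" by simp
    then show ?thesis using that by blast
  qed
  have \<sigma>_pow: "\<sigma> (w [^]\<^bsub>K\<^esub> i) = w [^]\<^bsub>K\<^esub> (t * i)" for i :: nat
    using w by (simp add: \<sigma>w K.nat_pow_pow)
  \<comment> \<open>Conjugating twice gives w back; this forces t to be odd.\<close>
  have tt: "t * t mod 8 = 1"
    using \<sigma>\<sigma>[OF w] w_eq[of "t * t" 1] w by (simp add: \<sigma>w \<sigma>_pow)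
  have t_cases: "t = 1 \<or> t = 3 \<or> t = 5 \<or> t = 7"
  proof -
    have "t = 0 \<or> t = 1 \<or> t = 2 \<or> t = 3 \<or> t = 4 \<or> t = 5 \<or> t = 6 \<or> t = 7" using t8 by linarith
    then show ?thesis using tt by auto
  qed
  \<comment> \<open>The primitive roots w of order 8 and w^2 of order 4 are fixed exactly when 8 and
    4, respectively, divide q - 1. This separates t = 1, then t = 5, from t = 3 and 7.\<close>
  have fix8: "t = 1 \<longleftrightarrow> 8 dvd q - 1"
    using conjugation_fixes_root_of_unity_iff[OF F(1,2) K.field_axioms fin_K h inj_h fixed w w_one] q(1)
      w_eq[of t 1] t8 w by (auto simp: \<sigma>w)
  have fix4: "2 * t mod 8 = 2 \<longleftrightarrow> 4 dvd q - 1"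
    using conjugation_fixes_root_of_unity_iff[OF F(1,2) K.field_axioms fin_K h inj_h fixed w2] q(1)
      w_eq[of "2 * t" 2] by (simp add: \<sigma>_pow mult.commute)
  define \<Omega> where "\<Omega> = {..<8::nat} \<times> {..<4::nat}"
  define \<tau> where "\<tau> c = (t * fst c mod 8, t * snd c mod 4)" for c :: "nat \<times> nat"
  \<comment> \<open>The character (r, s) sends the generator of C_8 to w^r and that of C_4 to w^(2
    s), a power of the primitive fourth root w^2.\<close>
  define \<chi> where "\<chi> c x = w [^]\<^bsub>K\<^esub> (nat (fst x) * fst c + 2 * nat (snd x) * snd c)" for c :: "nat \<times> nat" and x :: "int \<times> int"
  have m: "m = card {c \<in> \<Omega>. \<tau> c = c}"
    unfolding \<Omega>_def \<tau>_def card_fixed_multiplication_8_4[OF t_cases] m_def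
    using t_cases fix8 fix4 by auto
  have card_G: "card (carrier ?G) = 32" by (simp add: carrier_integer_mod_group card_cartesian_product)
  \<comment> \<open>Doubling turns residues modulo 4 into residues modulo 8, so both coordinates can
    be compared in one exponent of w modulo 8.\<close>
  have two: "2 * (n mod 4) = 2 * n mod 8" for n :: nat by (simp add: mult_mod_right)
  have two': "2 * a * (n mod 4) = a * (2 * n mod 8)" for a n :: nat by (simp flip: two)
  have mod_8: "(a * (i mod 8) + b * (j mod 8)) mod 8 = (a * i + b * j) mod 8" for a b i j :: nat
    by (intro mod_add_cong mod_mult_right_eq)
  have mod_8': "(i mod 8 * a + j mod 8 * b) mod 8 = (i * a + j * b) mod 8" for a b i j :: nat
    by (intro mod_add_cong mod_mult_left_eq)
  have "card (torsion (units_of A) d) = gcd d (card (carrier F) - 1) ^ card {c \<in> \<Omega>. \<tau> c = c} *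
    gcd d (card (carrier F) ^ 2 - 1) ^ ((card (carrier ?G) - card {c \<in> \<Omega>. \<tau> c = c}) div 2)"
  proof (rule card_torsion_units_characters[OF F(1,2) K.field_axioms fin_K card_K h inj_h \<sigma> \<sigma>\<sigma> fixed])
    show "finite \<Omega>" "card \<Omega> = card (carrier ?G)" unfolding card_G by (simp_all add: \<Omega>_def card_cartesian_product)
    fix c assume c: "c \<in> \<Omega>"
    show "\<tau> c \<in> \<Omega>" by (simp add: \<Omega>_def \<tau>_def)
    have "t * t mod 4 = 1" using t_cases by auto
    then have "t * (t * i mod 8) mod 8 = i mod 8" "t * (t * i mod 4) mod 4 = i mod 4" for i
      using tt by (metis mod_mult_left_eq mod_mult_right_eq mult.assoc mult_1)+
    then show "\<tau> (\<tau> c) = c" using c by (auto simp: \<tau>_def \<Omega>_def)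
    show "\<chi> c \<one>\<^bsub>?G\<^esub> = \<one>\<^bsub>K\<^esub>" by (simp add: \<chi>_def)
    fix x assume x: "x \<in> carrier ?G"
    then obtain a b where ab: "x = (int a, int b)"
      unfolding carrier_cyclic_8_4 by (elim SigmaE) (metis atLeastLessThan_iff nonneg_int_cases)
    show "\<chi> c x \<in> carrier K" using w by (simp add: \<chi>_def)
    show "\<sigma> (\<chi> c x) = \<chi> (\<tau> c) x"
      by (simp add: \<chi>_def \<sigma>_pow w_eq \<tau>_def ab two' mod_8) (simp add: algebra_simps)
    fix y assume "y \<in> carrier ?G"
    then obtain a' b' where ab': "y = (int a', int b')"
      unfolding carrier_cyclic_8_4 by (elim SigmaE) (metis atLeastLessThan_iff nonneg_int_cases)
    have "nat ((int a + int a') mod 8) = (a + a') mod 8" "nat ((int b + int b') mod 4) = (b + b') mod 4"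
      by (simp_all add: nat_mod_distrib nat_add_distrib)
    then show "\<chi> c (x \<otimes>\<^bsub>?G\<^esub> y) = \<chi> c x \<otimes>\<^bsub>K\<^esub> \<chi> c y"
      using w by (simp add: \<chi>_def K.nat_pow_mult w_eq ab ab' two mod_8') (simp add: algebra_simps)
  next
    fix f assume f: "f \<in> carrier A"
      and zero: "\<And>c. c \<in> \<Omega> \<Longrightarrow> (\<Oplus>\<^bsub>K\<^esub>x\<in>carrier ?G. h (f x) \<otimes>\<^bsub>K\<^esub> \<chi> c x) = \<zero>\<^bsub>K\<^esub>"
    define b where "b i j = h (f (int i, int j))" for i j :: nat
    have in_G: "(int i, int j) \<in> carrier ?G" if "i < 8" "j < 4" for i j :: nat
      using that by (simp add: carrier_integer_mod_group)
    have b: "b i j \<in> carrier K" if "i < 8" "j < 4" for i j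
      using f in_G[OF that] by (simp add: b_def A_apply)
    let ?v = "w [^]\<^bsub>K\<^esub> (2::nat)"
    have G_im: "carrier ?G = (\<lambda>(i, j). (int i, int j)) ` ({..<8} \<times> {..<4})"
    proof -
      have "{0..<int k} = int ` {..<k}" for k by (simp add: image_int_atLeastLessThan lessThan_atLeast0)
      from this[of 8] this[of 4] show ?thesis unfolding carrier_cyclic_8_4
        by (simp add: image_def set_eq_iff)
    qed
    \<comment> \<open>The character sum over the product group is an iterated transform. Inversion
      in i with w, for each fixed s, kills the inner sums; inversion in j with w^2 then kills the
      coefficients.\<close>
    have sums: "(\<Oplus>\<^bsub>K\<^esub>i\<in>{..<8}. (\<Oplus>\<^bsub>K\<^esub>j\<in>{..<4}. b i j \<otimes>\<^bsub>K\<^esub> ?v [^]\<^bsub>K\<^esub> (j * s)) \<otimes>\<^bsub>K\<^esub> w [^]\<^bsub>K\<^esub> (i * r)) = \<zero>\<^bsub>K\<^esub>"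
      if rs: "r < 8" "s < 4" for r s
    proof -
      have "(\<Oplus>\<^bsub>K\<^esub>i\<in>{..<8}. (\<Oplus>\<^bsub>K\<^esub>j\<in>{..<4}. b i j \<otimes>\<^bsub>K\<^esub> ?v [^]\<^bsub>K\<^esub> (j * s)) \<otimes>\<^bsub>K\<^esub> w [^]\<^bsub>K\<^esub> (i * r)) =
        (\<Oplus>\<^bsub>K\<^esub>i\<in>{..<8}. \<Oplus>\<^bsub>K\<^esub>j\<in>{..<4}. b i j \<otimes>\<^bsub>K\<^esub> \<chi> (r, s) (int i, int j))"
      proof (rule K.finsum_cong')
        fix i :: nat assume i: "i \<in> {..<8}"
        have "(\<Oplus>\<^bsub>K\<^esub>j\<in>{..<4}. b i j \<otimes>\<^bsub>K\<^esub> ?v [^]\<^bsub>K\<^esub> (j * s)) \<otimes>\<^bsub>K\<^esub> w [^]\<^bsub>K\<^esub> (i * r) =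
          (\<Oplus>\<^bsub>K\<^esub>j\<in>{..<4}. b i j \<otimes>\<^bsub>K\<^esub> ?v [^]\<^bsub>K\<^esub> (j * s) \<otimes>\<^bsub>K\<^esub> w [^]\<^bsub>K\<^esub> (i * r))"
          using i b w by (intro K.finsum_ldistr) auto
        also have "\<dots> = (\<Oplus>\<^bsub>K\<^esub>j\<in>{..<4}. b i j \<otimes>\<^bsub>K\<^esub> \<chi> (r, s) (int i, int j))"
          using i b w
          by (intro K.finsum_cong') (auto simp: \<chi>_def K.m_assoc K.nat_pow_pow K.nat_pow_mult ac_simps)
        finally show "(\<Oplus>\<^bsub>K\<^esub>j\<in>{..<4}. b i j \<otimes>\<^bsub>K\<^esub> ?v [^]\<^bsub>K\<^esub> (j * s)) \<otimes>\<^bsub>K\<^esub> w [^]\<^bsub>K\<^esub> (i * r) =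
          (\<Oplus>\<^bsub>K\<^esub>j\<in>{..<4}. b i j \<otimes>\<^bsub>K\<^esub> \<chi> (r, s) (int i, int j))" .
      qed (use b w in \<open>auto intro!: K.finsum_closed simp: \<chi>_def\<close>)
      also have "\<dots> = (\<Oplus>\<^bsub>K\<^esub>p\<in>{..<8} \<times> {..<4}. (\<lambda>x. h (f x) \<otimes>\<^bsub>K\<^esub> \<chi> (r, s) x) ((\<lambda>(i, j). (int i, int j)) p))"
        using b w by (subst K.finsum_Times) (auto simp: b_def \<chi>_def)
      also have "\<dots> = (\<Oplus>\<^bsub>K\<^esub>x\<in>carrier ?G. h (f x) \<otimes>\<^bsub>K\<^esub> \<chi> (r, s) x)"
        unfolding G_im using b w
        by (intro K.finsum_reindex[symmetric]) (auto simp: inj_on_def b_def \<chi>_def)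
      also have "\<dots> = \<zero>\<^bsub>K\<^esub>" using rs by (intro zero) (simp add: \<Omega>_def)
      finally show ?thesis .
    qed
    \<comment> \<open>Fourier inversion divides by the lengths 8 and 4, which are powers of the
      nonzero element 1 + 1.\<close>
    have two_K: "\<one>\<^bsub>K\<^esub> \<oplus>\<^bsub>K\<^esub> \<one>\<^bsub>K\<^esub> \<noteq> \<zero>\<^bsub>K\<^esub>" using F(3) by (simp add: K_simps)
    have "[(2 ^ k :: nat)] \<cdot>\<^bsub>K\<^esub> \<one>\<^bsub>K\<^esub> \<noteq> \<zero>\<^bsub>K\<^esub>" for k
      unfolding K.add_pow_two_power_one using K.pow_eq_zero[of "\<one>\<^bsub>K\<^esub> \<oplus>\<^bsub>K\<^esub> \<one>\<^bsub>K\<^esub>" k] two_K by auto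
    from this[of 3] this[of 2] have char: "[(8 :: nat)] \<cdot>\<^bsub>K\<^esub> \<one>\<^bsub>K\<^esub> \<noteq> \<zero>\<^bsub>K\<^esub>" "[(4 :: nat)] \<cdot>\<^bsub>K\<^esub> \<one>\<^bsub>K\<^esub> \<noteq> \<zero>\<^bsub>K\<^esub>"
      by simp_all
    have inner: "(\<Oplus>\<^bsub>K\<^esub>j\<in>{..<4}. b i j \<otimes>\<^bsub>K\<^esub> ?v [^]\<^bsub>K\<^esub> (j * s)) = \<zero>\<^bsub>K\<^esub>" if "i < 8" "s < 4" for i s
      by (rule K.fourier_injective[OF w w_one char(1) _ sums[OF _ that(2)] that(1)])
        (use b w in \<open>auto intro!: K.finsum_closed\<close>)
    have "b i j = \<zero>\<^bsub>K\<^esub>" if "i < 8" "j < 4" for i j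
      by (rule K.fourier_injective[OF w2(1,2) char(2) _ inner[OF that(1)] that(2)]) (use b that(1) in auto)
    then have "h (f x) = \<zero>\<^bsub>K\<^esub>" if "x \<in> carrier ?G" for x
      using that unfolding G_im b_def by auto
    then show "\<forall>x\<in>carrier ?G. f x = \<zero>\<^bsub>F\<^esub>" by (simp add: h_def K_simps)
  qed (simp_all add: d)
  then show ?thesis unfolding m card_G q(1) .
qed

section \<open>Comparison with the products of cyclic groups\<close>

theorem theorem3p3:
  fixes F :: "('a, 'm) ring_scheme" and p n q :: nat
  assumes "Factorial_Ring.prime p" and "n \<ge> 1" and "q = p ^ n"
    and "field F" and "finite (carrier F)" and "ring_char F = p" and "card (carrier F) = q"
  shows "(p = 2 \<longrightarrow>
      units_of (group_algebra F (cyclic 8 \<times>\<times> cyclic 4)) \<cong>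
      cyclic_power 8 n \<times>\<times> cyclic_power 4 (5 * n) \<times>\<times> cyclic_power 2 (18 * n) \<times>\<times> cyclic (2 ^ n - 1))
    \<and> (p \<noteq> 2 \<longrightarrow>
      ([int q = 1] (mod 8) \<longrightarrow>
        units_of (group_algebra F (cyclic 8 \<times>\<times> cyclic 4)) \<cong>
        cyclic_power (p ^ n - 1) 32) \<and>
      ([int q = -1] (mod 8) \<longrightarrow>
        units_of (group_algebra F (cyclic 8 \<times>\<times> cyclic 4)) \<cong>
        cyclic_power (p ^ n - 1) 4 \<times>\<times> cyclic_power (p ^ (2 * n) - 1) 14) \<and>
      ([int q = 3] (mod 8) \<longrightarrow>
        units_of (group_algebra F (cyclic 8 \<times>\<times> cyclic 4)) \<cong>
        cyclic_power (p ^ n - 1) 4 \<times>\<times> cyclic_power (p ^ (2 * n) - 1) 14) \<and>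
      ([int q = -3] (mod 8) \<longrightarrow>
        units_of (group_algebra F (cyclic 8 \<times>\<times> cyclic 4)) \<cong>
        cyclic_power (p ^ n - 1) 16 \<times>\<times> cyclic_power (p ^ (2 * n) - 1) 8))"
proof -
  interpret F: field F by fact
  interpret finite_group_algebra F "cyclic 8 \<times>\<times> cyclic 4"
    by (rule finite_group_algebra_cyclic_8_4[OF F.is_cring])
  have "finite (carrier A)" using assms(5) finite_G by (simp add: carrier_A finite_PiE)
  then have fin: "finite (carrier (units_of A))" by (auto simp: units_of_carrier Units_def)
  have iso: "units_of A \<cong> H" if "comm_group H" "finite (carrier H)"
    "\<And>d. d > 0 \<Longrightarrow> card (torsion (units_of A) d) = card (torsion H d)" for H :: "('b, 'c) monoid_scheme"
    using that fin by (intro iso_if_card_torsion_eq A.units_comm_group)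
  note group_simps = comm_group_DirProd comm_group_cyclic_power finite_cyclic_power
    torsion_DirProd card_cartesian_product card_torsion_cyclic_power card_torsion_integer_mod_group
  have p2: "p \<ge> 2" using assms(1) by (rule prime_ge_2_nat)
  have q2: "q \<ge> 2" using p2 assms(2) unfolding assms(3) by (metis le_trans power_increasing power_one_right le_simps(1) one_le_numeral order_trans)
  then have "1 < q ^ 2" by (intro one_less_power) auto
  then have pos: "q - 1 > 0" "q ^ 2 - 1 > 0" using q2 by auto
  have sq: "p ^ (2 * n) = q ^ 2" by (simp add: assms(3) power_mult mult.commute)
  show ?thesis
  proof (intro conjI impI)
    assume p: "p = 2"
    \<comment> \<open>\<open>integer_mod_group 0\<close> is infinite cyclic, so finiteness needs a
      positive modulus; n = 1 gives the trivial group.\<close>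
    have pos: "(2::nat) ^ n - 1 > 0" using pos(1) assms(3) p by simp
    show "units_of A \<cong>
      cyclic_power 8 n \<times>\<times> cyclic_power 4 (5 * n) \<times>\<times> cyclic_power 2 (18 * n) \<times>\<times> cyclic (2 ^ n - 1)"
    proof (rule iso)
      fix d :: nat assume "d > 0"
      then show "card (torsion (units_of A) d) = card (torsion (cyclic_power 8 n \<times>\<times>
          cyclic_power 4 (5 * n) \<times>\<times> cyclic_power 2 (18 * n) \<times>\<times> cyclic (2 ^ n - 1)) d)"
        using card_torsion_units_char_2[of F n d] assms p pos by (simp add: group_simps)
    qed (use pos in \<open>simp_all add: group_simps carrier_integer_mod_group del: carrier_product_group\<close>)
  next
    assume p: "p \<noteq> 2"
    have odd: "odd q" using prime_odd_nat[OF assms(1)] p p2 by (simp add: assms(3))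
    have "\<not> p dvd 2" using p p2 by (auto dest: dvd_imp_le)
    then have two: "\<one>\<^bsub>F\<^esub> \<oplus>\<^bsub>F\<^esub> \<one>\<^bsub>F\<^esub> \<noteq> \<zero>\<^bsub>F\<^esub>"
      using F.one_plus_one_eq_zero_iff assms(6) by simp
    note count = card_torsion_units_odd[OF assms(4,5) two assms(7) odd]
    \<comment> \<open>The bound q >= 2 keeps the subtraction on naturals from truncating.\<close>
    have dvd: "8 dvd q - 1 \<longleftrightarrow> q mod 8 = 1" "4 dvd q - 1 \<longleftrightarrow> q mod 8 = 1 \<or> q mod 8 = 5"
      using q2 by presburger+
    have split_iso: "units_of A \<cong> cyclic_power (p ^ n - 1) m \<times>\<times> cyclic_power (p ^ (2 * n) - 1) k"
      if "(if 8 dvd q - 1 then 32 else if 4 dvd q - 1 then 16 else 4) = m" "(32 - m) div 2 = k" for m k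
    proof (rule iso)
      fix d :: nat assume "d > 0"
      then show "card (torsion (units_of A) d) =
          card (torsion (cyclic_power (p ^ n - 1) m \<times>\<times> cyclic_power (p ^ (2 * n) - 1) k) d)"
        using count[of d] pos that by (simp add: group_simps sq flip: assms(3))
    qed (use pos in \<open>simp_all add: group_simps sq flip: assms(3) del: carrier_product_group\<close>)
    {
      assume "[int q = 1] (mod 8)"
      then have "int (q mod 8) = 1" by (simp add: cong_def zmod_int)
      then have "q mod 8 = 1" by linarith
      then have m: "8 dvd q - 1" using dvd by blast
      \<comment> \<open>All 32 characters are fixed here, so the group has no second factor and does
        not have the shape of \<open>split_iso\<close>.\<close>
      show "units_of A \<cong> cyclic_power (p ^ n - 1) 32"
      proof (rule iso)
        fix d :: nat assume "d > 0"
        then show "card (torsion (units_of A) d) = card (torsion (cyclic_power (p ^ n - 1) 32) d)"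
          using count[of d] pos m by (simp add: group_simps flip: assms(3))
      qed (use pos in \<open>simp_all add: group_simps flip: assms(3) del: carrier_product_group\<close>)
    next
      assume "[int q = - 1] (mod 8)"
      then have "int (q mod 8) = 7" by (simp add: cong_def zmod_int)
      then have "q mod 8 = 7" by linarith
      then show "units_of A \<cong> cyclic_power (p ^ n - 1) 4 \<times>\<times> cyclic_power (p ^ (2 * n) - 1) 14"
        using dvd by (intro split_iso) auto
    next
      assume "[int q = 3] (mod 8)"
      then have "int (q mod 8) = 3" by (simp add: cong_def zmod_int)
      then have "q mod 8 = 3" by linarith
      then show "units_of A \<cong> cyclic_power (p ^ n - 1) 4 \<times>\<times> cyclic_power (p ^ (2 * n) - 1) 14"
        using dvd by (intro split_iso) auto
    next
      assume "[int q = - 3] (mod 8)"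
      then have "int (q mod 8) = 5" by (simp add: cong_def zmod_int)
      then have "q mod 8 = 5" by linarith
      then show "units_of A \<cong> cyclic_power (p ^ n - 1) 16 \<times>\<times> cyclic_power (p ^ (2 * n) - 1) 8"
        using dvd by (intro split_iso) auto
    }
  qed
qed

end
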